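(* Let $T>0$ and let $a:[0,T]\times\mathbb{R}\to\mathbb{R}$ be a non-negative bounded Borel function. Let $z_1,z_2:[0,T]\to\mathcal M_+(\mathbb{R})$ be continuous with respect to the weak topology of finite measures on $\mathcal M(\mathbb{R})$, and let $z^0\in\mathcal M_+(\mathbb{R})$. Suppose that both $z_1$ and $z_2$ solve $\partial_t z=\partial^2_{xx}(az)$ in the sense of distributions with initial condition $z(0)=z^0$; more precisely, for $z=z_1$ and for $z=z_2$, $$\int_{\mathbb{R}}\varphi(x)\,z(t)(dx)=\int_{\mathbb{R}}\varphi(x)\,z^0(dx)+\int_0^t ds\int_{\mathbb{R}}\varphi''(x)\,a(s,x)\,z(s)(dx)$$ for every $t\in[0,T]$ and every $\varphi\in\mathcal S(\mathbb{R})$. Suppose moreover that $z:=z_1-z_2$ satisfies the following: there is $\rho:[0,T]\times\mathbb{R}\to\mathbb{R}$ belonging to $L^2([\kappa,T]\times\mathbb{R})$ for every $\kappa>0$ such that $\rho(t,\cdot)$ is the density of $z(t)$ for almost all $t\in]0,T]$. Then $(z_1-z_2)(t)$ is identically zero for every $t\in[0,T]$.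
   Context: $\mathcal M(\mathbb{R})$ is the set of all signed measures on $\mathbb{R}$ with finite total variation, and $\mathcal M_+(\mathbb{R})$ its subset of positive measures. The weak topology is the one induced by integration against bounded continuous functions. $\mathcal S(\mathbb{R})$ is the Schwartz space. Density means density with respect to Lebesgue measure. *)

theory Defs
  imports "HOL-Probability.Probability"
begin

definition schwartz_space :: "(real \<Rightarrow> real) set" where
  "schwartz_space = {\<phi>. (\<forall>n x. (deriv ^^ n) \<phi> field_differentiable (at x)) \<and>
     (\<forall>m n. bounded (range (\<lambda>x. x ^ m * (deriv ^^ n) \<phi> x)))}"

text \<open>The topology that the weak topology of finite signed measures induces on the positive
  finite measures: the initial topology for the maps sending a measure to its integral against a
  bounded continuous function. Here \<open>euclidean\<close> is the product topology on the real-valued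
  functions of a bounded continuous function.\<close>

definition weak_measure_topology :: "real measure topology" where
  "weak_measure_topology =
     pullback_topology {\<mu>. finite_borel_measure \<mu>}
       (\<lambda>\<mu> (f :: real \<Rightarrow>\<^sub>C real). \<integral>x. apply_bcontfun f x \<partial>\<mu>) euclidean"

lemma topspace_weak_measure_topology:
  "topspace weak_measure_topology = {\<mu>. finite_borel_measure \<mu>}"
  by (simp add: weak_measure_topology_def topspace_pullback_topology)

lemma continuous_map_weak_measure_topology_iff:
  fixes z :: "real \<Rightarrow> real measure"
  shows "continuous_map (top_of_set S) weak_measure_topology z \<longleftrightarrow>
    (\<forall>t\<in>S. finite_borel_measure (z t)) \<and>
    (\<forall>f :: real \<Rightarrow> real. continuous_on UNIV f \<longrightarrow> bounded (range f) \<longrightarrow>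
       continuous_on S (\<lambda>t. \<integral>x. f x \<partial>z t))"
    (is "?L \<longleftrightarrow> ?A \<and> ?B")
proof -
  let ?I = "\<lambda>\<mu> (f :: real \<Rightarrow>\<^sub>C real). \<integral>x. apply_bcontfun f x \<partial>\<mu>"
  have B: "?B \<longleftrightarrow> continuous_on S (?I \<circ> z)"
  proof
    assume ?B
    then show "continuous_on S (?I \<circ> z)"
      by (intro continuous_on_coordinatewise_then_product) auto
  next
    assume c: "continuous_on S (?I \<circ> z)"
    show ?B
    proof (intro allI impI)
      fix f :: "real \<Rightarrow> real" assume "continuous_on UNIV f" "bounded (range f)"
      then have "f \<in> bcontfun" by (simp add: bcontfun_def)
      then obtain g where g: "f = apply_bcontfun g" by (rule bcontfunE)
      show "continuous_on S (\<lambda>t. \<integral>x. f x \<partial>z t)"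
        using continuous_on_product_then_coordinatewise[OF c, of g] by (simp add: g)
    qed
  qed
  show ?thesis
  proof
    assume L: ?L
    have "continuous_map weak_measure_topology euclidean ?I"
      unfolding weak_measure_topology_def
      using continuous_map_pullback[of euclidean euclidean id] by fastforce
    with L have "continuous_on S (?I \<circ> z)"
      using continuous_map_compose continuous_map_iff_continuous by blast
    moreover have ?A
      using L by (auto simp: continuous_map_def topspace_weak_measure_topology)
    ultimately show "?A \<and> ?B" using B by blast
  next
    assume "?A \<and> ?B"
    then show ?L
      unfolding weak_measure_topology_def using B
      by (intro continuous_map_pullback') auto
  qed
qed

definition solves_diffusion ::
    "real \<Rightarrow> (real \<times> real \<Rightarrow> real) \<Rightarrow> real measure \<Rightarrow> (real \<Rightarrow> real measure) \<Rightarrow> bool" where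
  "solves_diffusion T a z0 z \<longleftrightarrow>
     (\<forall>t\<in>{0..T}. \<forall>\<phi>\<in>schwartz_space.
        (\<integral>x. \<phi> x \<partial>z t) = (\<integral>x. \<phi> x \<partial>z0) +
          (LBINT s:{0..t}. (\<integral>x. deriv (deriv \<phi>) x * a (s, x) \<partial>z s)))"

text \<open>Signed measures are represented by their values on Borel sets.\<close>

definition signed_diff :: "real measure \<Rightarrow> real measure \<Rightarrow> real set \<Rightarrow> real" where
  "signed_diff \<mu> \<nu> A = measure \<mu> A - measure \<nu> A"

definition is_signed_density :: "(real \<Rightarrow> real) \<Rightarrow> (real set \<Rightarrow> real) \<Rightarrow> bool" where
  "is_signed_density f \<zeta> \<longleftrightarrow>
     integrable lebesgue f \<and> (\<forall>A\<in>sets borel. \<zeta> A = (LINT x:A|lebesgue. f x))"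

definition square_integrable_on :: "('a::euclidean_space \<Rightarrow> real) \<Rightarrow> 'a set \<Rightarrow> bool" where
  "square_integrable_on f S \<longleftrightarrow>
     f \<in> borel_measurable (lebesgue_on S) \<and> integrable (lebesgue_on S) (\<lambda>p. (f p)\<^sup>2)"

end

theory Submission
  imports Defs
begin

text \<open>
  The proof is the resolvent argument of Brezis and Crandall, carried out on the Fourier side. Write
  \<open>Z t \<xi>\<close> and \<open>W t \<xi>\<close> for the Fourier transforms of the signed measures \<open>z(t)\<close> and
  \<open>a(t, \<cdot>) z(t)\<close>, where \<open>z = z1 - z2\<close>. Testing the equation with characters turns it into
  \<open>Z t \<xi> = - \<xi>\<^sup>2 \<integral>\<^sub>0\<^sup>t W s \<xi> ds\<close>, which gives
  \<open>|Z t \<xi>|\<^sup>2 - |Z \<kappa> \<xi>|\<^sup>2 = - 2 \<xi>\<^sup>2 \<integral>\<^sub>\<kappa>\<^sup>t W s \<xi> \<bullet> Z s \<xi> ds\<close>,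
  the product rule for a primitive, obtained from Fubini on a triangle (\<open>norm_primitive_square_diff\<close>).

  Multiply by \<open>exp (- (\<delta> \<xi>)\<^sup>2 / 2) / (\<epsilon> + \<xi>\<^sup>2)\<close>, integrate over \<open>\<xi>\<close>, and split
  \<open>\<xi>\<^sup>2 / (\<epsilon> + \<xi>\<^sup>2) = 1 - \<epsilon> / (\<epsilon> + \<xi>\<^sup>2)\<close> (\<open>energy_inequality\<close>). Since \<open>W\<close> and \<open>Z\<close> are
  bounded, the second part is at most a constant times \<open>\<integral> \<epsilon> / (\<epsilon> + \<xi>\<^sup>2) d\<xi>\<close>, which vanishes as
  \<open>\<epsilon> \<rightarrow> 0\<close>. In the first part, a Gaussian form of Parseval's identity (\<open>gaussian_parseval\<close>) rewrites
  \<open>\<integral> exp (- (\<delta> \<xi>)\<^sup>2 / 2) (W s \<xi> \<bullet> Z s \<xi>) d\<xi>\<close> as \<open>2 pi\<close> times the pairing of \<open>a \<rho>\<close> with \<open>\<rho>\<close> smoothed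
  at scale \<open>\<delta>\<close>; as \<open>\<rho>\<close> is square integrable, this tends to \<open>2 pi \<integral> a \<rho>\<^sup>2 \<ge> 0\<close> as \<open>\<delta> \<rightarrow> 0\<close>
  (\<open>gauss_corr_tendsto\<close>, \<open>dissipation_almost_nonnegative\<close>).

  The limits are taken in the order \<open>\<delta> \<rightarrow> 0\<close>, \<open>\<kappa> \<rightarrow> 0\<close>, \<open>\<epsilon> \<rightarrow> 0\<close>. The positive lower time \<open>\<kappa>\<close> is
  what makes the first limit possible, because \<open>\<rho>\<close> is controlled only away from time 0; the energy at
  time \<open>\<kappa>\<close>, with weight \<open>1 / (\<epsilon> + \<xi>\<^sup>2)\<close>, vanishes in the second limit because \<open>Z 0 = 0\<close>. What
  remains is \<open>\<integral> exp (- \<xi>\<^sup>2 / 2) / (1 + \<xi>\<^sup>2) |Z t \<xi>|\<^sup>2 d\<xi> \<le> 0\<close>, so \<open>Z t = 0\<close>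
  (\<open>dissipative_imp_zero\<close>), and a finite measure is determined by its Fourier transform.
\<close>

section \<open>Gaussian-damped cosines are Schwartz functions\<close>

text \<open>
  A class that contains the damped characters \<open>cos (\<xi> x + \<theta>) exp (- c x\<^sup>2)\<close> and is closed
  under differentiation and under multiplication by polynomials, so that membership in the Schwartz
  space reduces to boundedness of its elements. The phase \<open>\<theta>\<close> covers cosine and sine at once.
\<close>

definition gauss_trig :: "real \<Rightarrow> real \<Rightarrow> real \<Rightarrow> real poly \<Rightarrow> real poly \<Rightarrow> real \<Rightarrow> real" where
  "gauss_trig c \<xi> \<theta> p q x =
     (poly p x * cos (\<xi> * x + \<theta>) + poly q x * sin (\<xi> * x + \<theta>)) * exp (- (c * x\<^sup>2))"

lemma has_real_derivative_gauss_trig: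
  "(gauss_trig c \<xi> \<theta> p q has_real_derivative
     gauss_trig c \<xi> \<theta> (pderiv p + smult \<xi> q - [:0, 2 * c:] * p)
       (pderiv q - smult \<xi> p - [:0, 2 * c:] * q) x) (at x)"
  unfolding gauss_trig_def[abs_def]
  by (auto intro!: derivative_eq_intros) (simp add: algebra_simps power2_eq_square)

lemma deriv_gauss_trig:
  "deriv (gauss_trig c \<xi> \<theta> p q) =
     gauss_trig c \<xi> \<theta> (pderiv p + smult \<xi> q - [:0, 2 * c:] * p)
       (pderiv q - smult \<xi> p - [:0, 2 * c:] * q)"
  using DERIV_imp_deriv[OF has_real_derivative_gauss_trig] by blast

lemma poly_times_gaussian_bounded:
  fixes p :: "real poly"
  assumes "c > 0"
  shows "\<exists>K. \<forall>x. \<bar>poly p x\<bar> * exp (- (c * x\<^sup>2)) \<le> K"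
  using assms
proof (induction p arbitrary: c)
  case 0
  then show ?case by auto
next
  case (pCons a p)
  define d where "d = c / 2"
  have "d > 0" using pCons.prems by (simp add: d_def)
  then obtain K where K: "\<And>x. \<bar>poly p x\<bar> * exp (- (d * x\<^sup>2)) \<le> K"
    using pCons.IH by blast
  have lin: "\<bar>x\<bar> * exp (- (d * x\<^sup>2)) \<le> 1 + 1 / d" for x
  proof -
    have "\<bar>x\<bar> \<le> 1 + x\<^sup>2"
    proof (cases "\<bar>x\<bar> \<le> 1")
      case True
      then show ?thesis using zero_le_power2[of x] by linarith
    next
      case False
      then show ?thesis using self_le_power[of "\<bar>x\<bar>" 2] by simp
    qed
    also have "\<dots> \<le> (1 + 1 / d) * (1 + d * x\<^sup>2)"
    proof -
      have "(1 + 1 / d) * (1 + d * x\<^sup>2) = 1 + x\<^sup>2 + (d * x\<^sup>2 + 1 / d)"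
        using \<open>d > 0\<close> by (simp add: distrib_left distrib_right)
      moreover have "0 \<le> d * x\<^sup>2 + 1 / d" using \<open>d > 0\<close> by simp
      ultimately show ?thesis by linarith
    qed
    also have "\<dots> \<le> (1 + 1 / d) * exp (d * x\<^sup>2)"
      using \<open>d > 0\<close> by (intro mult_left_mono exp_ge_add_one_self) auto
    finally show ?thesis by (simp add: exp_minus field_simps)
  qed
  have "\<bar>poly (pCons a p) x\<bar> * exp (- (c * x\<^sup>2)) \<le> \<bar>a\<bar> + (1 + 1 / d) * K" for x
  proof -
    have split: "exp (- (c * x\<^sup>2)) = exp (- (d * x\<^sup>2)) * exp (- (d * x\<^sup>2))"
      unfolding d_def by (simp flip: exp_add)
    have "\<bar>poly (pCons a p) x\<bar> * exp (- (c * x\<^sup>2))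
        \<le> \<bar>a\<bar> * exp (- (c * x\<^sup>2)) + \<bar>x\<bar> * \<bar>poly p x\<bar> * exp (- (c * x\<^sup>2))"
      unfolding distrib_right[symmetric] abs_mult[symmetric] poly_pCons
      by (intro mult_right_mono abs_triangle_ineq) simp
    also have "\<bar>a\<bar> * exp (- (c * x\<^sup>2)) \<le> \<bar>a\<bar>"
      using pCons.prems by (simp add: mult_left_le)
    also have "\<bar>x\<bar> * \<bar>poly p x\<bar> * exp (- (c * x\<^sup>2))
        = (\<bar>x\<bar> * exp (- (d * x\<^sup>2))) * (\<bar>poly p x\<bar> * exp (- (d * x\<^sup>2)))"
      by (simp add: split)
    also have "\<dots> \<le> (1 + 1 / d) * K"
      using \<open>d > 0\<close> by (intro mult_mono lin K) auto
    finally show ?thesis by simp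
  qed
  then show ?case by blast
qed

lemma gauss_trig_bounded:
  assumes "c > 0"
  shows "bounded (range (gauss_trig c \<xi> \<theta> p q))"
proof -
  obtain K where K: "\<And>x. \<bar>poly p x\<bar> * exp (- (c * x\<^sup>2)) \<le> K"
    using poly_times_gaussian_bounded[OF assms] by blast
  obtain L where L: "\<And>x. \<bar>poly q x\<bar> * exp (- (c * x\<^sup>2)) \<le> L"
    using poly_times_gaussian_bounded[OF assms] by blast
  have "\<bar>gauss_trig c \<xi> \<theta> p q x\<bar> \<le> K + L" for x
  proof -
    have "\<bar>gauss_trig c \<xi> \<theta> p q x\<bar>
      \<le> (\<bar>poly p x\<bar> * \<bar>cos (\<xi> * x + \<theta>)\<bar> + \<bar>poly q x\<bar> * \<bar>sin (\<xi> * x + \<theta>)\<bar>) * exp (- (c * x\<^sup>2))"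
      unfolding gauss_trig_def abs_mult[of _ "exp _"] abs_exp_cancel abs_mult[symmetric]
      by (intro mult_right_mono abs_triangle_ineq) simp
    also have "\<dots> \<le> (\<bar>poly p x\<bar> + \<bar>poly q x\<bar>) * exp (- (c * x\<^sup>2))"
      by (intro mult_right_mono add_mono mult_left_le) auto
    also have "\<dots> \<le> K + L" using K[of x] L[of x] by (simp add: algebra_simps)
    finally show ?thesis .
  qed
  then show ?thesis unfolding bounded_iff by auto
qed

lemma gauss_trig_in_schwartz_space:
  assumes "c > 0"
  shows "gauss_trig c \<xi> \<theta> p q \<in> schwartz_space"
proof -
  have iter: "\<exists>p' q'. (deriv ^^ n) (gauss_trig c \<xi> \<theta> p q) = gauss_trig c \<xi> \<theta> p' q'" for n
    by (induction n) (auto, metis deriv_gauss_trig)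
  have "(deriv ^^ n) (gauss_trig c \<xi> \<theta> p q) field_differentiable (at x)" for n x
    using iter[of n] has_real_derivative_gauss_trig unfolding field_differentiable_def by metis
  moreover have "bounded (range (\<lambda>x. x ^ m * (deriv ^^ n) (gauss_trig c \<xi> \<theta> p q) x))" for m n
  proof -
    obtain p' q' where "(deriv ^^ n) (gauss_trig c \<xi> \<theta> p q) = gauss_trig c \<xi> \<theta> p' q'"
      using iter by blast
    then have "(\<lambda>x. x ^ m * (deriv ^^ n) (gauss_trig c \<xi> \<theta> p q) x)
        = gauss_trig c \<xi> \<theta> (monom 1 m * p') (monom 1 m * q')"
      by (auto simp: gauss_trig_def poly_monom algebra_simps)
    then show ?thesis using gauss_trig_bounded[OF assms] by metis
  qed
  ultimately show ?thesis by (simp add: schwartz_space_def)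
qed

lemma damped_cosine_second_derivative:
  "deriv (deriv (gauss_trig c \<xi> \<theta> 1 0)) =
     gauss_trig c \<xi> \<theta> [:- \<xi>\<^sup>2 - 2 * c, 0, 4 * c\<^sup>2:] [:0, 4 * c * \<xi>:]"
  unfolding deriv_gauss_trig
  by (rule ext) (simp add: gauss_trig_def pderiv_pCons one_pCons algebra_simps power2_eq_square)

text \<open>
  The bound is uniform in the damping parameter \<open>c\<close>: each power of \<open>x\<close> in the second derivative comes
  with a power of \<open>c\<close> that compensates it. It is the dominating constant for the limit \<open>c \<rightarrow> 0\<close>.
\<close>

lemma damped_cosine_second_derivative_bound:
  assumes "0 < c" "c \<le> 1"
  shows "\<bar>deriv (deriv (gauss_trig c \<xi> \<theta> 1 0)) x\<bar> \<le> \<xi>\<^sup>2 + 4 * \<bar>\<xi>\<bar> + 6"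
proof -
  define E where "E = exp (- (c * x\<^sup>2))"
  have E: "0 \<le> E" "E \<le> 1" using assms by (auto simp: E_def)
  have "(c * x\<^sup>2) * E \<le> exp (c * x\<^sup>2) * E"
    using E exp_ge_add_one_self[of "c * x\<^sup>2"] by (intro mult_right_mono) linarith+
  then have quad: "c * x\<^sup>2 * E \<le> 1" by (simp add: E_def exp_minus)
  have lin: "c * \<bar>x\<bar> * E \<le> 1"
  proof (cases "\<bar>x\<bar> \<le> 1")
    case True
    then have "c * \<bar>x\<bar> * E \<le> 1 * 1 * 1" using assms E by (intro mult_mono) auto
    then show ?thesis by simp
  next
    case False
    then have "\<bar>x\<bar> \<le> x\<^sup>2" using self_le_power[of "\<bar>x\<bar>" 2] by simp
    then have "c * \<bar>x\<bar> * E \<le> c * x\<^sup>2 * E" using assms E by (intro mult_right_mono mult_left_mono) auto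
    then show ?thesis using quad by simp
  qed
  let ?C = "cos (\<xi> * x + \<theta>)" and ?S = "sin (\<xi> * x + \<theta>)"
  have "deriv (deriv (gauss_trig c \<xi> \<theta> 1 0)) x =
      (- \<xi>\<^sup>2) * (E * ?C) + (- 2 * c) * (E * ?C) + (4 * c) * ((c * x\<^sup>2 * E) * ?C)
        + (4 * \<xi>) * ((c * x * E) * ?S)"
    by (simp add: damped_cosine_second_derivative gauss_trig_def E_def algebra_simps power2_eq_square)
  moreover have "\<bar>(- \<xi>\<^sup>2) * (E * ?C)\<bar> \<le> \<xi>\<^sup>2 * (1 * 1)"
    unfolding abs_mult using E by (intro mult_mono) auto
  moreover have "\<bar>(- 2 * c) * (E * ?C)\<bar> \<le> 2 * (1 * 1)"
    unfolding abs_mult using E assms by (intro mult_mono) auto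
  moreover have "\<bar>(4 * c) * ((c * x\<^sup>2 * E) * ?C)\<bar> \<le> 4 * (1 * 1)"
    unfolding abs_mult[of "4 * c"] abs_mult[of _ "?C"]
    using E assms quad by (intro mult_mono) auto
  moreover have "\<bar>(4 * \<xi>) * ((c * x * E) * ?S)\<bar> \<le> (4 * \<bar>\<xi>\<bar>) * (1 * 1)"
    unfolding abs_mult[of "4 * \<xi>"] abs_mult[of _ "?S"]
    using E assms lin by (intro mult_mono) (auto simp: abs_mult)
  ultimately show ?thesis by linarith
qed

section \<open>Measurable families of finite measures\<close>

lemma (in finite_borel_measure) integrable_bounded:
  fixes f :: "real \<Rightarrow> 'b::{banach, second_countable_topology}"
  assumes "f \<in> borel_measurable borel" "\<And>x. norm (f x) \<le> C"
  shows "integrable M f"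
  using assms by (intro integrable_const_bound[of _ C]) (auto simp: measurable_cong_sets[OF M_is_borel refl])

lemma (in finite_borel_measure) norm_integral_le:
  fixes f :: "real \<Rightarrow> 'b::{banach, second_countable_topology}"
  assumes "f \<in> borel_measurable borel" "\<And>x. norm (f x) \<le> C"
  shows "norm (\<integral>x. f x \<partial>M) \<le> C * measure M UNIV"
proof -
  have "norm (\<integral>x. f x \<partial>M) \<le> (\<integral>x. C \<partial>M)"
    by (rule Bochner_Integration.integral_norm_bound_integral[OF integrable_bounded[OF assms]]) (use assms in auto)
  then show ?thesis by (simp add: mult.commute add: borel_UNIV)
qed

text \<open>
  Transition kernels with uniformly bounded mass. They replace the weakly continuous curves of measures
  wherever integrals have to be measurable functions of time.
\<close>

locale bounded_kernel =
  fixes z :: "real \<Rightarrow> real measure" and B :: real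
  assumes finite_borel: "finite_borel_measure (z s)"
    and mass_le: "measure (z s) UNIV \<le> B"
    and emeasure_measurable: "A \<in> sets borel \<Longrightarrow> (\<lambda>s. emeasure (z s) A) \<in> borel_measurable borel"
begin

lemma sets_z [simp, measurable_cong]: "sets (z s) = sets borel"
  using finite_borel by (simp add: finite_borel_measure.M_is_borel)

lemma space_z [simp]: "space (z s) = UNIV"
  using sets_eq_imp_space_eq[OF sets_z[of s]] by simp

lemma B_nonneg: "0 \<le> B"
  using mass_le[of 0] measure_nonneg[of "z 0" UNIV] by linarith

lemma norm_integral_le:
  fixes f :: "real \<Rightarrow> 'b::{banach, second_countable_topology}"
  assumes "f \<in> borel_measurable borel" "\<And>x. norm (f x) \<le> C"
  shows "norm (\<integral>x. f x \<partial>z s) \<le> C * B"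
proof -
  have "0 \<le> C" using assms(2)[of 0] norm_ge_zero order_trans by blast
  then show ?thesis
    using finite_borel_measure.norm_integral_le[OF finite_borel assms] mass_le[of s]
      mult_left_mono order_trans by blast
qed

text \<open>
  After division by \<open>B + 1\<close> the kernel takes values in the subprobability measures, where
  measurability of nonnegative integrals is known; adding the constant \<open>C\<close> makes \<open>f\<close> nonnegative.
\<close>

lemma integral_measurable_real:
  fixes f :: "'p \<Rightarrow> real \<Rightarrow> real"
  assumes f [measurable]: "case_prod f \<in> borel_measurable (M \<Otimes>\<^sub>M borel)"
    and \<sigma> [measurable]: "\<sigma> \<in> borel_measurable M"
    and bnd: "\<And>p x. p \<in> space M \<Longrightarrow> \<bar>f p x\<bar> \<le> C"
  shows "(\<lambda>p. \<integral>x. f p x \<partial>z (\<sigma> p)) \<in> borel_measurable M"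
proof -
  define r where "r = ennreal (1 / (B + 1))"
  define K where "K p = scale_measure r (z (\<sigma> p))" for p
  have [measurable]: "K \<in> measurable M (subprob_algebra borel)"
  proof (rule measurable_subprob_algebra)
    fix p
    interpret finite_borel_measure "z (\<sigma> p)" by (rule finite_borel)
    have "emeasure (K p) UNIV \<le> 1"
      using mass_le[of "\<sigma> p"] B_nonneg
      by (simp add: K_def r_def emeasure_eq_measure divide_simps ennreal_le_1 flip: ennreal_mult)
    then show "subprob_space (K p)"
      by (intro subprob_spaceI) (auto simp: K_def space_scale_measure)
    show "sets (K p) = sets borel" by (simp add: K_def)
  next
    fix A :: "real set" assume [measurable]: "A \<in> sets borel"
    show "(\<lambda>p. emeasure (K p) A) \<in> borel_measurable M"
      using measurable_compose[OF \<sigma> emeasure_measurable[of A]] by (simp add: K_def)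
  qed
  have "(\<lambda>p. \<integral>\<^sup>+x. ennreal (f p x + C) \<partial>K p) \<in> borel_measurable M"
    by (rule nn_integral_measurable_subprob_algebra2[where N = borel]) measurable
  moreover have "(\<lambda>p. measure (z (\<sigma> p)) UNIV) \<in> borel_measurable M"
    using measurable_compose[OF \<sigma> emeasure_measurable[of UNIV]] unfolding measure_def by simp
  ultimately have "(\<lambda>p. (B + 1) * enn2real (\<integral>\<^sup>+x. ennreal (f p x + C) \<partial>K p)
      - C * measure (z (\<sigma> p)) UNIV) \<in> borel_measurable M"
    by measurable
  moreover have "(\<integral>x. f p x \<partial>z (\<sigma> p)) =
      (B + 1) * enn2real (\<integral>\<^sup>+x. ennreal (f p x + C) \<partial>K p) - C * measure (z (\<sigma> p)) UNIV"
    if p: "p \<in> space M" for p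
  proof -
    interpret finite_borel_measure "z (\<sigma> p)" by (rule finite_borel)
    have m [measurable]: "(\<lambda>x. f p x) \<in> borel_measurable borel"
      using p by measurable
    have int: "integrable (z (\<sigma> p)) (\<lambda>x. f p x)"
      using bnd[OF p] by (intro integrable_bounded m) auto
    have "enn2real (\<integral>\<^sup>+x. ennreal (f p x + C) \<partial>K p)
        = 1 / (B + 1) * enn2real (\<integral>\<^sup>+x. ennreal (f p x + C) \<partial>z (\<sigma> p))"
      using B_nonneg
      by (simp add: K_def nn_integral_scale_measure enn2real_mult r_def)
    also have "enn2real (\<integral>\<^sup>+x. ennreal (f p x + C) \<partial>z (\<sigma> p)) = (\<integral>x. f p x + C \<partial>z (\<sigma> p))"
      using bnd[OF p] by (intro integral_eq_nn_integral[symmetric])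
        (auto simp: abs_le_iff intro!: AE_I2, smt (verit))
    also have "\<dots> = (\<integral>x. f p x \<partial>z (\<sigma> p)) + C * measure (z (\<sigma> p)) UNIV"
      using int by (simp add: mult.commute)
    finally show ?thesis using B_nonneg by (simp add: field_simps)
  qed
  ultimately show ?thesis by (simp cong: measurable_cong)
qed

lemma integral_measurable:
  fixes f :: "'p \<Rightarrow> real \<Rightarrow> complex"
  assumes f [measurable]: "case_prod f \<in> borel_measurable (M \<Otimes>\<^sub>M borel)"
    and \<sigma> [measurable]: "\<sigma> \<in> borel_measurable M"
    and bnd: "\<And>p x. p \<in> space M \<Longrightarrow> norm (f p x) \<le> C"
  shows "(\<lambda>p. \<integral>x. f p x \<partial>z (\<sigma> p)) \<in> borel_measurable M"
proof -
  have "(\<lambda>p. \<integral>x. Re (f p x) \<partial>z (\<sigma> p)) \<in> borel_measurable M"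
    by (rule integral_measurable_real[where C = C])
       (use bnd abs_Re_le_cmod order_trans in \<open>auto, blast\<close>)
  moreover have "(\<lambda>p. \<integral>x. Im (f p x) \<partial>z (\<sigma> p)) \<in> borel_measurable M"
    by (rule integral_measurable_real[where C = C])
       (use bnd abs_Im_le_cmod order_trans in \<open>auto, blast\<close>)
  ultimately have "(\<lambda>p. Complex (\<integral>x. Re (f p x) \<partial>z (\<sigma> p)) (\<integral>x. Im (f p x) \<partial>z (\<sigma> p)))
      \<in> borel_measurable M"
    unfolding Complex_eq by measurable
  moreover have "(\<integral>x. f p x \<partial>z (\<sigma> p)) =
      Complex (\<integral>x. Re (f p x) \<partial>z (\<sigma> p)) (\<integral>x. Im (f p x) \<partial>z (\<sigma> p))"
    if p: "p \<in> space M" for p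
  proof -
    interpret finite_borel_measure "z (\<sigma> p)" by (rule finite_borel)
    have "integrable (z (\<sigma> p)) (\<lambda>x. f p x)"
      using bnd[OF p] p by (intro integrable_bounded[where C = C]) measurable
    then show ?thesis by (simp add: complex_eq_iff)
  qed
  ultimately show ?thesis by (simp cong: measurable_cong)
qed

end

text \<open>
  The mass of a half line is a limit of integrals of continuous functions, hence measurable in the
  parameter; a monotone class argument passes from half lines to Borel sets.
\<close>

lemma weakly_continuous_imp_bounded_kernel:
  fixes z :: "real \<Rightarrow> real measure"
  assumes fin: "\<And>t. finite_borel_measure (z t)"
    and cont: "\<And>f :: real \<Rightarrow> real. continuous_on UNIV f \<Longrightarrow> bounded (range f) \<Longrightarrow>
       continuous_on UNIV (\<lambda>t. \<integral>x. f x \<partial>z t)"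
    and mass: "\<And>t. measure (z t) UNIV \<le> B"
  shows "bounded_kernel z B"
proof (rule bounded_kernel.intro)
  show "finite_borel_measure (z s)" for s by (rule fin)
  show "measure (z s) UNIV \<le> B" for s by (rule mass)
  have sets: "sets (z s) = sets borel" for s
    using fin[of s] finite_borel_measure.M_is_borel by blast
  have space: "space (z s) = UNIV" for s
    using sets_eq_imp_space_eq[OF sets[of s]] by simp
  have cts_le_1: "\<bar>cts_step b c x\<bar> \<le> 1" if "b < c" for b c x
    using that by (auto simp: cts_step_def divide_le_eq)
  have atMost: "(\<lambda>s. measure (z s) {..b}) \<in> borel_measurable borel" for b
  proof (rule borel_measurable_LIMSEQ_real)
    let ?f = "\<lambda>n. cts_step b (b + 1 / real (Suc n))"
    show "(\<lambda>s. \<integral>x. ?f n x \<partial>z s) \<in> borel_measurable borel" for n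
    proof (intro borel_measurable_continuous_onI cont)
      show "continuous_on UNIV (?f n)"
        by (intro uniformly_continuous_imp_continuous cts_step_uniformly_continuous) simp
      show "bounded (range (?f n))"
        using cts_le_1[of b "b + 1 / real (Suc n)"] by (auto simp: bounded_iff)
    qed
    fix s
    interpret finite_borel_measure "z s" by (rule fin)
    have "(\<lambda>n. \<integral>x. ?f n x \<partial>z s) \<longlonglongrightarrow> (\<integral>x. indicator {..b} x \<partial>z s)"
    proof (rule integral_dominated_convergence[where w = "\<lambda>_. 1"])
      have *: "(\<lambda>n. ?f n x) \<longlonglongrightarrow> indicator {..b} x" for x
      proof (cases "x \<le> b")
        case False
        have "(\<lambda>n. b + 1 / real (Suc n)) \<longlonglongrightarrow> b + 0"
          by (intro tendsto_intros LIMSEQ_inverse_real_of_nat[unfolded inverse_eq_divide])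
        then have "\<forall>\<^sub>F n in sequentially. b + 1 / real (Suc n) < x"
          using False by (intro order_tendstoD) auto
        then show ?thesis
          using False by (intro tendsto_eventually) (auto elim!: eventually_mono simp: cts_step_def)
      qed (simp add: cts_step_def)
      then show "AE x in z s. (\<lambda>n. ?f n x) \<longlonglongrightarrow> indicator {..b} x" by simp
      show "?f n \<in> borel_measurable (z s)" for n
        using cts_step_uniformly_continuous[of b "b + 1 / real (Suc n)"]
        by (simp add: sets borel_measurable_continuous_onI uniformly_continuous_imp_continuous
            cong: measurable_cong_sets)
      show "AE x in z s. norm (?f n x) \<le> 1" for n
        using cts_le_1[of b "b + 1 / real (Suc n)"] by simp
    qed (auto simp: sets cong: measurable_cong_sets)
    then show "(\<lambda>n. \<integral>x. ?f n x \<partial>z s) \<longlonglongrightarrow> measure (z s) {..b}" by (simp add: space)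
  qed
  fix A :: "real set" assume A: "A \<in> sets borel"
  have ems: "emeasure (z s) X = ennreal (measure (z s) X)" for s X
    using fin[of s] finite_measure.emeasure_eq_measure finite_borel_measure.axioms(1) by blast
  have total: "(\<lambda>s. measure (z s) UNIV) \<in> borel_measurable borel"
    using cont[of "\<lambda>_. 1"] by (simp add: space borel_measurable_continuous_onI)
  have stable: "Int_stable (range (atMost :: real \<Rightarrow> real set))"
    by (auto simp: Int_stable_def)
  have "A \<in> sigma_sets UNIV (range (atMost :: real \<Rightarrow> real set))"
    using A by (simp add: borel_eq_atMost)
  with stable subset_UNIV[of "range atMost", folded Pow_UNIV]
  have "(\<lambda>s. measure (z s) A) \<in> borel_measurable borel"
  proof (induction rule: sigma_sets_induct_disjoint)
    case (basic A) then show ?case using atMost by auto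
  next
    case empty then show ?case by simp
  next
    case (compl A)
    then have "A \<in> sets borel" by (simp add: borel_eq_atMost)
    then have "measure (z s) (UNIV - A) = measure (z s) UNIV - measure (z s) A" for s
      using finite_measure.finite_measure_compl[of "z s" A] fin[of s] finite_borel_measure.axioms(1)
      by (auto simp: sets space)
    then show ?case using compl.IH total by simp
  next
    case (union A)
    then have rA: "range A \<subseteq> sets borel" by (auto simp: borel_eq_atMost)
    have "measure (z s) (\<Union> (range A)) = (\<Sum>i. measure (z s) (A i))" for s
    proof -
      interpret finite_borel_measure "z s" by (rule fin)
      show ?thesis
        using finite_measure_UNION[of A] rA union.hyps by (auto simp: sets sums_iff)
    qed
    then show ?case using union.IH by (simp add: borel_measurable_suminf)
  qed
  then show "(\<lambda>s. emeasure (z s) A) \<in> borel_measurable borel"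
    using A by (simp add: ems)
qed

section \<open>The equation tested with characters\<close>

lemma integrable_indicator_Icc: "integrable lborel (indicat_real {s..t :: real})"
  by (intro integrable_real_indicator) (simp_all add: emeasure_lborel_Icc_eq)

text \<open>
  Only times in \<open>[0,T]\<close> matter, so the data may be extended to the whole line in a measurable way.
\<close>

lemma solves_diffusion_cong:
  assumes "solves_diffusion T a z0 z"
    and "\<And>t. t \<in> {0..T} \<Longrightarrow> z' t = z t"
    and "\<And>t x. t \<in> {0..T} \<Longrightarrow> a' (t, x) = a (t, x)"
  shows "solves_diffusion T a' z0 z'"
proof -
  have "(LBINT s:{0..t}. (\<integral>x. deriv (deriv \<phi>) x * a' (s, x) \<partial>z' s)) =
      (LBINT s:{0..t}. (\<integral>x. deriv (deriv \<phi>) x * a (s, x) \<partial>z s))" if "t \<in> {0..T}" for t \<phi>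
    using that assms(2,3) by (intro set_lebesgue_integral_cong) auto
  then show ?thesis using assms unfolding solves_diffusion_def by simp
qed

lemma gauss_trig_borel_measurable [measurable]: "gauss_trig c \<xi> \<theta> p q \<in> borel_measurable borel"
  using has_real_derivative_gauss_trig DERIV_continuous
  by (intro borel_measurable_continuous_onI continuous_at_imp_continuous_on) blast

lemma gauss_trig_tendsto:
  assumes "c \<longlonglongrightarrow> 0"
  shows "(\<lambda>n. gauss_trig (c n) \<xi> \<theta> 1 0 x) \<longlonglongrightarrow> cos (\<xi> * x + \<theta>)"
    and "(\<lambda>n. deriv (deriv (gauss_trig (c n) \<xi> \<theta> 1 0)) x) \<longlonglongrightarrow> - \<xi>\<^sup>2 * cos (\<xi> * x + \<theta>)"
  unfolding damped_cosine_second_derivative gauss_trig_def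
  by (auto intro!: tendsto_eq_intros assms)

text \<open>
  Characters are not Schwartz functions; they are reached by dominated convergence from the damped
  cosines as \<open>c \<rightarrow> 0\<close>, because the measures are finite and \<open>a\<close> is bounded.
\<close>

lemma (in bounded_kernel) solves_diffusion_cos:
  assumes a [measurable]: "a \<in> borel_measurable (borel \<Otimes>\<^sub>M borel)"
    and a_le: "\<And>p. \<bar>a p\<bar> \<le> K"
    and z0: "finite_borel_measure z0"
    and sol: "solves_diffusion T a z0 z" and t: "t \<in> {0..T}"
  shows "(\<integral>x. cos (\<xi> * x + \<theta>) \<partial>z t) = (\<integral>x. cos (\<xi> * x + \<theta>) \<partial>z0)
    - \<xi>\<^sup>2 * (LBINT s:{0..t}. (\<integral>x. cos (\<xi> * x + \<theta>) * a (s, x) \<partial>z s))"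
proof -
  define c where "c n = 1 / real (Suc n)" for n
  have c: "0 < c n" "c n \<le> 1" for n by (auto simp: c_def)
  have c0: "c \<longlonglongrightarrow> 0"
    unfolding c_def using LIMSEQ_inverse_real_of_nat by (simp add: inverse_eq_divide)
  define \<phi> where "\<phi> n = gauss_trig (c n) \<xi> \<theta> 1 0" for n
  define D where "D = \<xi>\<^sup>2 + 4 * \<bar>\<xi>\<bar> + 6"
  have D: "0 \<le> D" by (simp add: D_def)
  have \<phi>_le: "\<bar>\<phi> n x\<bar> \<le> 1" for n x
    using c(1)[of n] by (auto simp: \<phi>_def gauss_trig_def abs_mult intro!: mult_le_one)
  have [measurable]: "\<phi> n \<in> borel_measurable borel" for n by (simp add: \<phi>_def)
  have [measurable]: "deriv (deriv (\<phi> n)) \<in> borel_measurable borel" for n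
    by (simp add: \<phi>_def damped_cosine_second_derivative)
  have conv: "(\<lambda>n. \<integral>x. \<phi> n x \<partial>\<mu>) \<longlonglongrightarrow> (\<integral>x. cos (\<xi> * x + \<theta>) \<partial>\<mu>)"
    if "finite_borel_measure \<mu>" for \<mu>
  proof -
    interpret finite_borel_measure \<mu> by fact
    note [measurable_cong] = M_is_borel
    show ?thesis
      by (rule integral_dominated_convergence[where w = "\<lambda>_. 1"])
         (use \<phi>_le gauss_trig_tendsto(1)[OF c0] in \<open>auto simp: \<phi>_def\<close>)
  qed
  define g where "g n s = (\<integral>x. deriv (deriv (\<phi> n)) x * a (s, x) \<partial>z s)" for n s
  define h where "h s = (\<integral>x. cos (\<xi> * x + \<theta>) * a (s, x) \<partial>z s)" for s
  have integrand_le: "\<bar>deriv (deriv (\<phi> n)) x * a p\<bar> \<le> D * K" for n x p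
    unfolding abs_mult \<phi>_def D_def
    using damped_cosine_second_derivative_bound[OF c] a_le by (intro mult_mono) auto
  have [measurable]: "g n \<in> borel_measurable borel" for n
    unfolding g_def by (rule integral_measurable_real[where C = "D * K"]) (use integrand_le in auto)
  have [measurable]: "h \<in> borel_measurable borel"
    unfolding h_def
  proof (rule integral_measurable_real[where C = "1 * K"])
    show "\<bar>cos (\<xi> * x + \<theta>) * a (p, x)\<bar> \<le> 1 * K" for p x
      unfolding abs_mult using a_le by (intro mult_mono) auto
  qed auto
  have g_le: "\<bar>g n s\<bar> \<le> D * K * B" for n s
    using norm_integral_le[of "\<lambda>x. deriv (deriv (\<phi> n)) x * a (s, x)" "D * K" s] integrand_le
    by (simp add: g_def)
  have g_lim: "(\<lambda>n. g n s) \<longlonglongrightarrow> - \<xi>\<^sup>2 * h s" for s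
  proof -
    interpret finite_borel_measure "z s" by (rule finite_borel)
    have "(\<lambda>n. g n s) \<longlonglongrightarrow> (\<integral>x. - \<xi>\<^sup>2 * (cos (\<xi> * x + \<theta>) * a (s, x)) \<partial>z s)"
      unfolding g_def
    proof (rule integral_dominated_convergence[where w = "\<lambda>_. D * K"])
      have "(\<lambda>n. deriv (deriv (\<phi> n)) x * a (s, x)) \<longlonglongrightarrow> (- \<xi>\<^sup>2 * cos (\<xi> * x + \<theta>)) * a (s, x)" for x
        unfolding \<phi>_def by (intro tendsto_mult_right gauss_trig_tendsto(2) c0)
      then show "AE x in z s. (\<lambda>n. deriv (deriv (\<phi> n)) x * a (s, x)) \<longlonglongrightarrow>
          - \<xi>\<^sup>2 * (cos (\<xi> * x + \<theta>) * a (s, x))"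
        by (simp add: mult.assoc)
    qed (use integrand_le in auto)
    then show ?thesis by (simp add: h_def)
  qed
  have "(\<lambda>n. LBINT s:{0..t}. g n s) \<longlonglongrightarrow> (LBINT s:{0..t}. - \<xi>\<^sup>2 * h s)"
    unfolding set_lebesgue_integral_def
  proof (rule integral_dominated_convergence[where w = "\<lambda>s. D * K * B * indicator {0..t} s"])
    show "integrable lborel (\<lambda>s. D * K * B * indicator {0..t} s)"
      by (intro integrable_mult_right integrable_indicator_Icc)
    show "AE s in lborel. norm (indicator {0..t} s *\<^sub>R g n s) \<le> D * K * B * indicator {0..t} s" for n
      using g_le by (simp split: split_indicator)
    show "AE s in lborel. (\<lambda>n. indicator {0..t} s *\<^sub>R g n s) \<longlonglongrightarrow> indicator {0..t} s *\<^sub>R (- \<xi>\<^sup>2 * h s)"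
      by (intro AE_I2 tendsto_scaleR g_lim tendsto_const)
  qed auto
  then have "(\<lambda>n. (\<integral>x. \<phi> n x \<partial>z0) + (LBINT s:{0..t}. g n s)) \<longlonglongrightarrow>
      (\<integral>x. cos (\<xi> * x + \<theta>) \<partial>z0) + (LBINT s:{0..t}. - \<xi>\<^sup>2 * h s)"
    by (intro tendsto_add conv z0)
  moreover have "(\<integral>x. \<phi> n x \<partial>z t) = (\<integral>x. \<phi> n x \<partial>z0) + (LBINT s:{0..t}. g n s)" for n
    using sol t gauss_trig_in_schwartz_space[OF c(1)[of n]]
    unfolding solves_diffusion_def g_def \<phi>_def by blast
  ultimately have "(\<integral>x. cos (\<xi> * x + \<theta>) \<partial>z t)
      = (\<integral>x. cos (\<xi> * x + \<theta>) \<partial>z0) + (LBINT s:{0..t}. - \<xi>\<^sup>2 * h s)"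
    using conv[OF finite_borel[of t]] LIMSEQ_unique by simp
  also have "(LBINT s:{0..t}. - \<xi>\<^sup>2 * h s) = - \<xi>\<^sup>2 * (LBINT s:{0..t}. h s)"
    by (rule set_integral_mult_right)
  finally show ?thesis by (simp add: h_def)
qed

text \<open>
  The real part is the previous lemma with \<open>\<theta> = 0\<close>, the imaginary part with \<open>\<theta> = - pi / 2\<close>.
\<close>

lemma (in bounded_kernel) solves_diffusion_char:
  assumes a [measurable]: "a \<in> borel_measurable (borel \<Otimes>\<^sub>M borel)"
    and a_le: "\<And>p. \<bar>a p\<bar> \<le> K"
    and z0: "finite_borel_measure z0"
    and sol: "solves_diffusion T a z0 z" and t: "t \<in> {0..T}"
  shows "char (z t) \<xi> = char z0 \<xi>
    - \<xi>\<^sup>2 *\<^sub>R (LBINT s:{0..t}. (\<integral>x. a (s, x) *\<^sub>R iexp (\<xi> * x) \<partial>z s))"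
proof -
  have iexp: "iexp y = Complex (cos y) (cos (y + - pi / 2))" for y
    by (simp add: complex_eq_iff Re_exp Im_exp cos_diff)
  have int: "integrable \<mu> (\<lambda>x. iexp (\<xi> * x))" if "finite_borel_measure \<mu>" for \<mu>
    using that by (intro finite_borel_measure.integrable_bounded[where C = 1]) auto
  have w_le: "norm (a (s, x) *\<^sub>R iexp (\<xi> * x)) \<le> K" for s x
    using a_le by simp
  have w_int: "integrable (z s) (\<lambda>x. a (s, x) *\<^sub>R iexp (\<xi> * x))" for s
    using w_le by (intro finite_borel_measure.integrable_bounded[OF finite_borel, where C = K]) auto
  define W where "W s = (\<integral>x. a (s, x) *\<^sub>R iexp (\<xi> * x) \<partial>z s)" for s
  have [measurable]: "W \<in> borel_measurable borel"
    unfolding W_def by (rule integral_measurable[where C = K]) (use w_le in auto)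
  have W_le: "norm (W s) \<le> K * B" for s
    unfolding W_def using w_le by (intro norm_integral_le) auto
  have W_int: "integrable lborel (\<lambda>s. indicator {0..t} s *\<^sub>R W s)"
  proof (rule Bochner_Integration.integrable_bound[where f = "\<lambda>s. K * B * indicator {0..t} s"])
    show "integrable lborel (\<lambda>s. K * B * indicat_real {0..t} s)"
      by (intro integrable_mult_right integrable_indicator_Icc)
    show "AE s in lborel. norm (indicator {0..t} s *\<^sub>R W s) \<le> norm (K * B * indicat_real {0..t} s)"
      using W_le by (auto split: split_indicator intro: order_trans[OF _ abs_ge_self])
  qed simp
  have Re_W: "Re (W s) = (\<integral>x. cos (\<xi> * x + 0) * a (s, x) \<partial>z s)"
    and Im_W: "Im (W s) = (\<integral>x. cos (\<xi> * x + - pi / 2) * a (s, x) \<partial>z s)" for s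
    using w_int[of s]
    by (simp_all add: W_def Re_exp Im_exp cos_diff mult.commute flip: integral_Re integral_Im)
  have Re_char: "Re (char \<mu> \<xi>) = (\<integral>x. cos (\<xi> * x + 0) \<partial>\<mu>)"
    and Im_char: "Im (char \<mu> \<xi>) = (\<integral>x. cos (\<xi> * x + - pi / 2) \<partial>\<mu>)"
    if "finite_borel_measure \<mu>" for \<mu>
    using int[OF that]
    by (simp_all add: char_def Re_exp Im_exp cos_diff flip: integral_Re integral_Im)
  have Re_LBINT: "Re (LBINT s:{0..t}. W s) = (LBINT s:{0..t}. Re (W s))"
    and Im_LBINT: "Im (LBINT s:{0..t}. W s) = (LBINT s:{0..t}. Im (W s))"
    using W_int by (simp_all add: set_lebesgue_integral_def flip: integral_Re integral_Im)
  show ?thesis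
    unfolding W_def[symmetric]
  proof (rule complex_eqI)
    show "Re (char (z t) \<xi>) = Re (char z0 \<xi> - \<xi>\<^sup>2 *\<^sub>R (LBINT s:{0..t}. W s))"
      using solves_diffusion_cos[OF a a_le z0 sol t, of \<xi> 0]
      by (simp only: minus_complex.simps scaleR_complex.simps Re_LBINT Re_W Re_char z0 finite_borel)
    show "Im (char (z t) \<xi>) = Im (char z0 \<xi> - \<xi>\<^sup>2 *\<^sub>R (LBINT s:{0..t}. W s))"
      using solves_diffusion_cos[OF a a_le z0 sol t, of \<xi> "- pi / 2"]
      by (simp only: minus_complex.simps scaleR_complex.simps Im_LBINT Im_W Im_char z0 finite_borel)
  qed
qed

section \<open>The squared norm of a primitive\<close>

lemma integrable_pair_norm_product:
  fixes f :: "real \<Rightarrow> 'a::{banach, second_countable_topology}"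
    and g :: "real \<Rightarrow> 'b::{banach, second_countable_topology}"
  assumes f: "integrable lborel f" and g: "integrable lborel g"
  shows "integrable (lborel \<Otimes>\<^sub>M lborel) (\<lambda>(x, y). norm (f x) * norm (g y))"
proof -
  have [measurable]: "f \<in> borel_measurable borel" "g \<in> borel_measurable borel"
    using borel_measurable_integrable[OF f] borel_measurable_integrable[OF g] by simp_all
  show ?thesis
    by (rule lborel_pair.Fubini_integrable) (use f g in auto)
qed

text \<open>
  The double integral of the symmetric function \<open>(s, r) \<mapsto> w s \<bullet> w r\<close> is twice its integral over
  the half plane \<open>r \<le> s\<close>, the diagonal being a null set.
\<close>

lemma norm_integral_square:
  fixes w :: "real \<Rightarrow> complex"
  assumes w: "integrable lborel w"
  shows "(norm (\<integral>s. w s \<partial>lborel))\<^sup>2 =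
    2 * (\<integral>s. w s \<bullet> (\<integral>r. indicator {..s} r *\<^sub>R w r \<partial>lborel) \<partial>lborel)"
proof -
  have [measurable]: "w \<in> borel_measurable borel"
    using borel_measurable_integrable[OF w] by simp
  let ?J = "\<integral>s. w s \<bullet> (\<integral>r. indicator {..s} r *\<^sub>R w r \<partial>lborel) \<partial>lborel"
  define P where "P = (\<lambda>(s, r). w s \<bullet> w r)"
  define L where "L = (\<lambda>(s, r). indicator {..s} r * (w s \<bullet> w r) :: real)"
  define U where "U = (\<lambda>(s, r). indicator {..<r} s * (w s \<bullet> w r) :: real)"
  have [measurable]: "P \<in> borel_measurable (lborel \<Otimes>\<^sub>M lborel)"
    unfolding P_def by measurable
  have L_alt: "L = (\<lambda>p. if snd p \<le> fst p then P p else 0)"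
    and U_alt: "U = (\<lambda>p. if fst p < snd p then P p else 0)"
    by (auto simp: L_def U_def P_def indicator_def)
  have [measurable]: "L \<in> borel_measurable (lborel \<Otimes>\<^sub>M lborel)"
    "U \<in> borel_measurable (lborel \<Otimes>\<^sub>M lborel)"
    unfolding L_alt U_alt by measurable
  have int: "integrable (lborel \<Otimes>\<^sub>M lborel) L" "integrable (lborel \<Otimes>\<^sub>M lborel) U"
    by (rule Bochner_Integration.integrable_bound[OF integrable_pair_norm_product[OF w w]];
        auto simp: L_def U_def indicator_def intro!: Cauchy_Schwarz_ineq2)+
  have intP: "integrable (lborel \<Otimes>\<^sub>M lborel) P"
    by (rule Bochner_Integration.integrable_bound[OF integrable_pair_norm_product[OF w w]])
       (auto simp: P_def intro!: Cauchy_Schwarz_ineq2)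
  have slice: "integrable lborel (\<lambda>r. indicator A r *\<^sub>R w r)" if [measurable]: "A \<in> sets borel" for A
    using integrable_mult_indicator[OF _ w, of A] by simp
  have J_L: "(\<integral>p. L p \<partial>(lborel \<Otimes>\<^sub>M lborel)) = ?J"
  proof -
    have "(\<integral>p. L p \<partial>(lborel \<Otimes>\<^sub>M lborel)) = (\<integral>s. \<integral>r. L (s, r) \<partial>lborel \<partial>lborel)"
      by (rule lborel_pair.integral_fst'[symmetric, OF int(1)])
    also have "\<dots> = ?J"
      by (intro Bochner_Integration.integral_cong refl)
         (simp add: L_def slice flip: integral_inner_right inner_scaleR_right)
    finally show ?thesis .
  qed
  have J_U: "(\<integral>p. U p \<partial>(lborel \<Otimes>\<^sub>M lborel)) = ?J"
  proof -
    have "(\<integral>p. U p \<partial>(lborel \<Otimes>\<^sub>M lborel)) = (\<integral>r. \<integral>s. U (s, r) \<partial>lborel \<partial>lborel)"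
      using lborel_pair.integral_snd[of "\<lambda>s r. U (s, r)"] int(2) by simp
    also have "\<dots> = ?J"
    proof (intro Bochner_Integration.integral_cong refl)
      fix r
      have "(\<integral>s. U (s, r) \<partial>lborel) = w r \<bullet> (\<integral>s. indicator {..<r} s *\<^sub>R w s \<partial>lborel)"
      proof -
        have "(\<lambda>s. U (s, r)) = (\<lambda>s. w r \<bullet> (indicator {..<r} s *\<^sub>R w s))"
          by (simp add: U_def inner_commute)
        then show ?thesis by (simp only: integral_inner_right slice lessThan_borel)
      qed
      also have "(\<integral>s. indicator {..<r} s *\<^sub>R w s \<partial>lborel) = (\<integral>s. indicator {..r} s *\<^sub>R w s \<partial>lborel)"
        by (rule integral_cong_AE)
           (use AE_lborel_singleton[of r] in \<open>auto elim!: eventually_mono simp: indicator_def\<close>)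
      finally show "(\<integral>s. U (s, r) \<partial>lborel) = w r \<bullet> (\<integral>s. indicator {..r} s *\<^sub>R w s \<partial>lborel)" .
    qed
    finally show ?thesis .
  qed
  have "(norm (\<integral>s. w s \<partial>lborel))\<^sup>2 = (\<integral>s. w s \<partial>lborel) \<bullet> (\<integral>s. w s \<partial>lborel)"
    by (simp add: power2_norm_eq_inner)
  also have "\<dots> = (\<integral>s. \<integral>r. P (s, r) \<partial>lborel \<partial>lborel)"
    using w by (simp add: P_def)
  also have "\<dots> = (\<integral>p. P p \<partial>(lborel \<Otimes>\<^sub>M lborel))"
    by (rule lborel_pair.integral_fst'[OF intP])
  also have "\<dots> = (\<integral>p. L p + U p \<partial>(lborel \<Otimes>\<^sub>M lborel))"
    by (intro Bochner_Integration.integral_cong refl) (auto simp: L_alt U_alt)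
  also have "\<dots> = 2 * ?J"
    using int by (simp add: J_L J_U)
  finally show ?thesis .
qed

text \<open>
  The product rule for \<open>F \<bullet> F\<close>, without differentiating \<open>F\<close>, which is only absolutely continuous.
\<close>

lemma norm_primitive_square_diff:
  fixes w :: "real \<Rightarrow> complex"
  assumes [measurable]: "w \<in> borel_measurable borel" and bnd: "\<And>s. norm (w s) \<le> C"
    and "0 \<le> \<kappa>" "\<kappa> \<le> t"
  defines "F \<equiv> \<lambda>t. LBINT s:{0..t}. w s"
  shows "(norm (F t))\<^sup>2 - (norm (F \<kappa>))\<^sup>2 = 2 * (LBINT s:{\<kappa>..t}. w s \<bullet> F s)"
proof -
  have C: "0 \<le> C" using bnd[of 0] norm_ge_zero order_trans by blast
  have int: "integrable lborel (\<lambda>s. indicator {0..t} s *\<^sub>R w s)" for t :: real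
    by (rule Bochner_Integration.integrable_bound[where f = "\<lambda>s. C * indicator {0..t} s"])
       (use bnd C in \<open>simp_all add: AE_I2 integrable_indicator_Icc split: split_indicator\<close>)
  have sq: "(norm (F t))\<^sup>2 = 2 * (LBINT s:{0..t}. w s \<bullet> F s)" if "0 \<le> t" for t
  proof -
    have "(norm (F t))\<^sup>2 = 2 * (\<integral>s. (indicator {0..t} s *\<^sub>R w s) \<bullet>
       (\<integral>r. indicator {..s} r *\<^sub>R (indicator {0..t} r *\<^sub>R w r) \<partial>lborel) \<partial>lborel)"
      unfolding F_def set_lebesgue_integral_def by (rule norm_integral_square[OF int])
    also have "(\<integral>s. (indicator {0..t} s *\<^sub>R w s) \<bullet>
       (\<integral>r. indicator {..s} r *\<^sub>R (indicator {0..t} r *\<^sub>R w r) \<partial>lborel) \<partial>lborel)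
       = (LBINT s:{0..t}. w s \<bullet> F s)"
      unfolding F_def set_lebesgue_integral_def
    proof (intro Bochner_Integration.integral_cong refl)
      fix s
      have "indicator {..s} r *\<^sub>R (indicator {0..t} r *\<^sub>R w r) = indicator {0..s} r *\<^sub>R w r"
        if "s \<in> {0..t}" for r
        using that by (auto simp: indicator_def)
      then have "(\<integral>r. indicator {..s} r *\<^sub>R (indicator {0..t} r *\<^sub>R w r) \<partial>lborel)
          = (\<integral>r. indicator {0..s} r *\<^sub>R w r \<partial>lborel)" if "s \<in> {0..t}"
        using that by (intro Bochner_Integration.integral_cong refl)
      then show "(indicator {0..t} s *\<^sub>R w s) \<bullet>
          (\<integral>r. indicator {..s} r *\<^sub>R (indicator {0..t} r *\<^sub>R w r) \<partial>lborel) =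
          indicator {0..t} s *\<^sub>R (w s \<bullet> (\<integral>r. indicator {0..s} r *\<^sub>R w r \<partial>lborel))"
        by (cases "s \<in> {0..t}") (simp_all del: scaleR_scaleR)
    qed
    finally show ?thesis .
  qed
  have meas [measurable]: "F \<in> borel_measurable borel"
  proof -
    have "(\<lambda>t. \<integral>s. (if 0 \<le> s \<and> s \<le> t then w s else 0) \<partial>lborel) \<in> borel_measurable borel"
      by measurable
    also have "(\<lambda>t. \<integral>s. (if 0 \<le> s \<and> s \<le> t then w s else 0) \<partial>lborel) = F"
      unfolding F_def set_lebesgue_integral_def
      by (intro ext Bochner_Integration.integral_cong) (auto simp: indicator_def)
    finally show ?thesis .
  qed
  have Fbnd: "norm (F s) \<le> C * t" if "s \<in> {0..t}" for s t
  proof -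
    have "norm (F s) \<le> (\<integral>r. C * indicator {0..s} r \<partial>lborel)"
      unfolding F_def set_lebesgue_integral_def
      by (rule Bochner_Integration.integral_norm_bound_integral[OF int])
         (use bnd C in \<open>simp_all add: integrable_indicator_Icc split: split_indicator\<close>)
    also have "\<dots> \<le> C * t" using that C by (simp add: mult_left_mono)
    finally show ?thesis .
  qed
  have sint: "set_integrable lborel {0..t} (\<lambda>s. w s \<bullet> F s)" for t
    unfolding set_integrable_def
  proof (rule Bochner_Integration.integrable_bound[where f = "\<lambda>s. C * (C * t) * indicator {0..t} s"])
    have "\<bar>w s \<bullet> F s\<bar> \<le> C * (C * t)" if "s \<in> {0..t}" for s
      using Cauchy_Schwarz_ineq2[of "w s" "F s"] mult_mono[OF bnd[of s] Fbnd[OF that] C norm_ge_zero]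
      by linarith
    then show "AE s in lborel. norm (indicator {0..t} s *\<^sub>R (w s \<bullet> F s))
        \<le> norm (C * (C * t) * indicator {0..t} s)"
      by (auto simp: indicator_def intro!: order_trans[OF _ abs_ge_self])
  qed (use integrable_indicator_Icc in auto)
  have "(LBINT s:{0..t}. w s \<bullet> F s) = (LBINT s:{0..\<kappa>}. w s \<bullet> F s) + (LBINT s:{\<kappa>..t}. w s \<bullet> F s)"
  proof -
    have "{0..t} = {0..\<kappa>} \<union> {\<kappa>..t}" using assms by auto
    moreover have "AE x in lborel. \<not> (x \<in> {0..\<kappa>} \<and> x \<in> {\<kappa>..t})"
      using AE_lborel_singleton[of \<kappa>] by eventually_elim auto
    moreover have "set_integrable lborel {0..\<kappa>} (\<lambda>s. w s \<bullet> F s)"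
      "set_integrable lborel {\<kappa>..t} (\<lambda>s. w s \<bullet> F s)"
      by (rule set_integrable_subset[OF sint[of t]]; use assms(3,4) in auto)+
    ultimately show ?thesis
      using set_integral_Un_AE[where M = lborel and A = "{0..\<kappa>}" and B = "{\<kappa>..t}"] by simp
  qed
  with sq[of t] sq[of \<kappa>] assms(3,4) show ?thesis by simp
qed

section \<open>Gaussian averages in \<open>L\<^sup>2\<close>\<close>

definition clip :: "real \<Rightarrow> real \<Rightarrow> real" where
  "clip b y = max (- b) (min b y)"

lemma abs_clip_le: "0 \<le> b \<Longrightarrow> \<bar>clip b y\<bar> \<le> b"
  by (auto simp: clip_def)

lemma abs_diff_clip_le: "0 \<le> b \<Longrightarrow> \<bar>y - clip b y\<bar> \<le> \<bar>y\<bar>"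
  by (auto simp: clip_def)

lemma clip_eq: "\<bar>y\<bar> \<le> b \<Longrightarrow> clip b y = y"
  by (auto simp: clip_def)

lemma integrable_inverse_one_plus_square: "integrable lborel (\<lambda>x::real. 1 / (1 + x\<^sup>2))"
  using integrable_inverse_1_plus_square
  by (simp add: set_integrable_def einterval_def inverse_eq_divide)

text \<open>
  Truncating \<open>f\<close> at height \<open>n / (1 + x\<^sup>2)\<close> makes it bounded and square integrable in one step. The
  truncation is then an almost everywhere limit of continuous functions, and truncating these at the
  same height provides the dominating function.
\<close>

lemma continuous_bounded_dense_L2:
  fixes f :: "real \<Rightarrow> real"
  assumes [measurable]: "f \<in> borel_measurable borel"
    and f2: "integrable lborel (\<lambda>x. (f x)\<^sup>2)" and "0 < e"
  obtains g M where "continuous_on UNIV g" "\<And>x. \<bar>g x\<bar> \<le> M"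
    "integrable lborel (\<lambda>x. (g x)\<^sup>2)" "(\<integral>x. (f x - g x)\<^sup>2 \<partial>lborel) < e"
proof -
  define w :: "real \<Rightarrow> real" where "w x = 1 / (1 + x\<^sup>2)" for x
  have pos: "0 < 1 + x\<^sup>2" for x :: real by (simp add: add_pos_nonneg)
  have w: "0 < w x" "w x \<le> 1" for x using pos[of x] by (auto simp: w_def)
  have [measurable]: "w \<in> borel_measurable borel" unfolding w_def[abs_def] by measurable
  have w_cont: "continuous_on UNIV w"
    unfolding w_def[abs_def] using pos by (intro continuous_intros) (auto simp: less_imp_neq[symmetric])
  have w2: "integrable lborel (\<lambda>x. (w x)\<^sup>2)"
  proof (rule Bochner_Integration.integrable_bound)
    show "integrable lborel w"
      unfolding w_def[abs_def] by (rule integrable_inverse_one_plus_square)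
    show "AE x in lborel. norm ((w x)\<^sup>2) \<le> norm (w x)"
      using w by (intro AE_I2) (simp add: power2_eq_square abs_mult mult_left_le less_imp_le)
  qed simp
  define F where "F n x = clip (real n * w x) (f x)" for n x
  have Fm [measurable]: "F n \<in> borel_measurable borel" for n
    unfolding F_def[abs_def] clip_def by measurable
  have "(\<lambda>n. \<integral>x. (f x - F n x)\<^sup>2 \<partial>lborel) \<longlonglongrightarrow> (\<integral>x. 0 \<partial>(lborel :: real measure))"
  proof (rule integral_dominated_convergence[where w = "\<lambda>x. (f x)\<^sup>2"])
    show "AE x in lborel. (\<lambda>n. (f x - F n x)\<^sup>2) \<longlonglongrightarrow> 0"
    proof (intro AE_I2 tendsto_eventually)
      fix x
      obtain N where N: "\<bar>f x\<bar> / w x \<le> real N" using real_arch_simple by blast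
      have "\<bar>f x\<bar> \<le> real n * w x" if "N \<le> n" for n
      proof -
        have "\<bar>f x\<bar> \<le> real N * w x" using N w(1)[of x] by (simp add: field_simps)
        also have "\<dots> \<le> real n * w x" using that w(1)[of x] by (intro mult_right_mono) auto
        finally show ?thesis .
      qed
      then show "\<forall>\<^sub>F n in sequentially. (f x - F n x)\<^sup>2 = 0"
        unfolding eventually_sequentially F_def by (intro exI[of _ N]) (simp add: clip_eq)
    qed
    show "AE x in lborel. norm ((f x - F n x)\<^sup>2) \<le> (f x)\<^sup>2" for n
    proof (intro AE_I2)
      fix x
      have "\<bar>f x - F n x\<bar> \<le> \<bar>f x\<bar>"
        unfolding F_def using w(1)[of x] by (intro abs_diff_clip_le) (simp add: less_imp_le)
      then show "norm ((f x - F n x)\<^sup>2) \<le> (f x)\<^sup>2" by (simp add: abs_le_square_iff)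
    qed
  qed (use f2 in simp_all)
  then have "\<forall>\<^sub>F n in sequentially. (\<integral>x. (f x - F n x)\<^sup>2 \<partial>lborel) < e / 4"
    using \<open>0 < e\<close> by (intro order_tendstoD) auto
  then obtain m where m: "(\<integral>x. (f x - F m x)\<^sup>2 \<partial>lborel) < e / 4"
    by (auto simp: eventually_sequentially)
  have "f measurable_on UNIV"
    by (rule lebesgue_measurable_imp_measurable_on_real) (simp_all add: measurable_completion)
  then obtain N G where NG: "negligible N \<and> (\<forall>n. continuous_on UNIV (G n)) \<and>
      (\<forall>x. x \<notin> N \<longrightarrow> (\<lambda>n. G n x) \<longlonglongrightarrow> (if x \<in> UNIV then f x else 0))"
    unfolding measurable_on_def by blast
  then have N: "negligible N" and G_cont: "\<And>n. continuous_on UNIV (G n)"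
    and G_lim: "\<And>x. x \<notin> N \<Longrightarrow> (\<lambda>n. G n x) \<longlonglongrightarrow> f x"
    by simp_all
  have AE_N: "AE x in lborel. x \<notin> N"
    using AE_not_in[of N lebesgue] N by (simp add: negligible_iff_null_sets AE_completion_iff)
  define H where "H n x = clip (real m * w x) (G n x)" for n x
  have H_cont: "continuous_on UNIV (H n)" for n
    unfolding H_def clip_def using G_cont[of n] w_cont by (intro continuous_intros)
  then have [measurable]: "H n \<in> borel_measurable borel" for n
    by (rule borel_measurable_continuous_onI)
  have bnd: "\<bar>H n x\<bar> \<le> real m * w x" "\<bar>F m x\<bar> \<le> real m * w x" for n x
    unfolding H_def F_def using w(1)[of x] by (auto intro!: abs_clip_le simp: less_imp_le)
  have dom: "integrable lborel (\<lambda>x. (2 * real m)\<^sup>2 * (w x)\<^sup>2)" using w2 by simp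
  have "(\<lambda>n. \<integral>x. (F m x - H n x)\<^sup>2 \<partial>lborel) \<longlonglongrightarrow> (\<integral>x. (F m x - F m x)\<^sup>2 \<partial>lborel)"
  proof (rule integral_dominated_convergence[where w = "\<lambda>x. (2 * real m)\<^sup>2 * (w x)\<^sup>2"])
    show "AE x in lborel. (\<lambda>n. (F m x - H n x)\<^sup>2) \<longlonglongrightarrow> (F m x - F m x)\<^sup>2"
      using AE_N
    proof eventually_elim
      case (elim x)
      then show ?case
        unfolding F_def H_def clip_def by (intro tendsto_intros G_lim)
    qed
    show "AE x in lborel. norm ((F m x - H n x)\<^sup>2) \<le> (2 * real m)\<^sup>2 * (w x)\<^sup>2" for n
    proof (intro AE_I2)
      fix x
      have "\<bar>F m x - H n x\<bar> \<le> \<bar>2 * real m * w x\<bar>"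
        using bnd(1)[of n x] bnd(2)[of x] by linarith
      then show "norm ((F m x - H n x)\<^sup>2) \<le> (2 * real m)\<^sup>2 * (w x)\<^sup>2"
        by (simp only: abs_le_square_iff power_mult_distrib) simp
    qed
  qed (use dom in simp_all)
  then have "\<forall>\<^sub>F n in sequentially. (\<integral>x. (F m x - H n x)\<^sup>2 \<partial>lborel) < e / 4"
    using \<open>0 < e\<close> by (intro order_tendstoD) auto
  then obtain n where n: "(\<integral>x. (F m x - H n x)\<^sup>2 \<partial>lborel) < e / 4"
    by (auto simp: eventually_sequentially)
  have H2: "integrable lborel (\<lambda>x. (H n x)\<^sup>2)" and F2: "integrable lborel (\<lambda>x. (F m x)\<^sup>2)"
    and FH2: "integrable lborel (\<lambda>x. (F m x - H n x)\<^sup>2)"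
  proof -
    have *: "integrable lborel (\<lambda>x. (u x)\<^sup>2)"
      if [measurable]: "u \<in> borel_measurable borel" and "\<And>x. \<bar>u x\<bar> \<le> 2 * (real m * w x)" for u
    proof (rule Bochner_Integration.integrable_bound[OF dom])
      show "AE x in lborel. norm ((u x)\<^sup>2) \<le> norm ((2 * real m)\<^sup>2 * (w x)\<^sup>2)"
      proof (intro AE_I2)
        fix x
        have "\<bar>u x\<bar> \<le> \<bar>2 * real m * w x\<bar>" using that(2)[of x] by linarith
        then show "norm ((u x)\<^sup>2) \<le> norm ((2 * real m)\<^sup>2 * (w x)\<^sup>2)"
          by (simp only: abs_le_square_iff power_mult_distrib) simp
      qed
    qed simp
    have wm: "0 \<le> real m * w x" for x using w(1)[of x] by simp
    show "integrable lborel (\<lambda>x. (H n x)\<^sup>2)" "integrable lborel (\<lambda>x. (F m x)\<^sup>2)"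
      "integrable lborel (\<lambda>x. (F m x - H n x)\<^sup>2)"
      using bnd(1)[of n] bnd(2) wm by (intro *; measurable?; smt (verit))+
  qed
  have fF2: "integrable lborel (\<lambda>x. (f x - F m x)\<^sup>2)"
  proof (rule Bochner_Integration.integrable_bound[OF f2])
    show "AE x in lborel. norm ((f x - F m x)\<^sup>2) \<le> norm ((f x)\<^sup>2)"
    proof (intro AE_I2)
      fix x
      have "\<bar>f x - F m x\<bar> \<le> \<bar>f x\<bar>"
        unfolding F_def using w(1)[of x] by (intro abs_diff_clip_le) (simp add: less_imp_le)
      then show "norm ((f x - F m x)\<^sup>2) \<le> norm ((f x)\<^sup>2)" by (simp add: abs_le_square_iff)
    qed
  qed simp
  have sq: "(f x - H n x)\<^sup>2 \<le> 2 * (f x - F m x)\<^sup>2 + 2 * (F m x - H n x)\<^sup>2" for x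
    using zero_le_power2[of "(f x - F m x) - (F m x - H n x)"]
    by (simp add: power2_eq_square algebra_simps)
  have "(\<integral>x. (f x - H n x)\<^sup>2 \<partial>lborel)
      \<le> (\<integral>x. 2 * (f x - F m x)\<^sup>2 + 2 * (F m x - H n x)\<^sup>2 \<partial>lborel)"
    using fF2 FH2 sq by (intro integral_mono') auto
  also have "\<dots> = 2 * (\<integral>x. (f x - F m x)\<^sup>2 \<partial>lborel) + 2 * (\<integral>x. (F m x - H n x)\<^sup>2 \<partial>lborel)"
    using fF2 FH2 by simp
  also have "\<dots> < e" using m n by simp
  finally have "(\<integral>x. (f x - H n x)\<^sup>2 \<partial>lborel) < e" .
  moreover have "\<bar>H n x\<bar> \<le> real m" for x
    using bnd(1)[of n x] w[of x] mult_left_le[of "w x" "real m"] by linarith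
  ultimately show thesis using that H_cont H2 by blast
qed

text \<open>
  The pairing of \<open>h\<close> with the convolution of \<open>f\<close> and the centred Gaussian of standard deviation \<open>\<delta>\<close>.
  Rescaling the Gaussian variable removes \<open>\<delta>\<close> from the density, so that \<open>\<delta> \<rightarrow> 0\<close> only moves the
  argument of \<open>f\<close>.
\<close>

definition gauss_corr :: "(real \<Rightarrow> real) \<Rightarrow> (real \<Rightarrow> real) \<Rightarrow> real \<Rightarrow> real" where
  "gauss_corr f h \<delta> = (\<integral>(v, y). std_normal_density v * (f (y + \<delta> * v) * h y) \<partial>(lborel \<Otimes>\<^sub>M lborel))"

lemma gauss_weighted_shift_integral:
  fixes u :: "real \<Rightarrow> real"
  assumes u: "integrable lborel u" and nonneg: "\<And>x. 0 \<le> u x"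
  shows "integrable (lborel \<Otimes>\<^sub>M lborel) (\<lambda>(v, y). std_normal_density v * u (y + \<delta> * v))"
    and "(\<integral>(v, y). std_normal_density v * u (y + \<delta> * v) \<partial>(lborel \<Otimes>\<^sub>M lborel)) = (\<integral>x. u x \<partial>lborel)"
proof -
  have [measurable]: "u \<in> borel_measurable borel"
    using borel_measurable_integrable[OF u] by simp
  have shift: "integrable lborel (\<lambda>y. u (y + c))" "(\<integral>y. u (y + c) \<partial>lborel) = (\<integral>x. u x \<partial>lborel)" for c
    using lborel_integrable_real_affine[OF u, of 1 c] lborel_integral_real_affine[of 1 u c]
    by (simp_all add: add.commute)
  show int: "integrable (lborel \<Otimes>\<^sub>M lborel) (\<lambda>(v, y). std_normal_density v * u (y + \<delta> * v))"
    by (rule lborel_pair.Fubini_integrable) (use shift nonneg in \<open>auto simp: abs_mult\<close>)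
  show "(\<integral>(v, y). std_normal_density v * u (y + \<delta> * v) \<partial>(lborel \<Otimes>\<^sub>M lborel)) = (\<integral>x. u x \<partial>lborel)"
    using lborel_pair.integral_fst[OF int] shift by simp
qed

text \<open>
  The weight \<open>k\<close> lets products of square integrable functions be made small when only one factor is.
\<close>

lemma weighted_young:
  fixes p q :: real
  assumes "0 < k"
  shows "\<bar>p * q\<bar> \<le> (k * p\<^sup>2 + q\<^sup>2 / k) / 2"
proof -
  have "0 \<le> (k * \<bar>p\<bar> - \<bar>q\<bar>)\<^sup>2 / k" using assms by simp
  also have "\<dots> = k * p\<^sup>2 + q\<^sup>2 / k - 2 * \<bar>p * q\<bar>"
    using assms by (simp add: power2_diff power_mult_distrib abs_mult field_simps power2_eq_square)
  finally show ?thesis by simp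
qed

lemma gauss_corr_bound:
  assumes [measurable]: "f \<in> borel_measurable borel" "h \<in> borel_measurable borel"
    and f2: "integrable lborel (\<lambda>x. (f x)\<^sup>2)" and h2: "integrable lborel (\<lambda>x. (h x)\<^sup>2)" and "0 < k"
  shows "integrable (lborel \<Otimes>\<^sub>M lborel) (\<lambda>(v, y). std_normal_density v * (f (y + \<delta> * v) * h y))"
    and "\<bar>gauss_corr f h \<delta>\<bar> \<le> (k * (\<integral>x. (f x)\<^sup>2 \<partial>lborel) + (\<integral>x. (h x)\<^sup>2 \<partial>lborel) / k) / 2"
proof -
  let ?d = "\<lambda>(v, y). (k * (std_normal_density v * (f (y + \<delta> * v))\<^sup>2)
      + (std_normal_density v * (h (y + 0 * v))\<^sup>2) / k) / 2"
  note F = gauss_weighted_shift_integral[OF f2, of \<delta>] and H = gauss_weighted_shift_integral[OF h2, of 0]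
  have d: "integrable (lborel \<Otimes>\<^sub>M lborel) ?d"
    using F(1) H(1) by (simp add: case_prod_unfold)
  have d_eq: "(\<integral>p. ?d p \<partial>(lborel \<Otimes>\<^sub>M lborel))
      = (k * (\<integral>x. (f x)\<^sup>2 \<partial>lborel) + (\<integral>x. (h x)\<^sup>2 \<partial>lborel) / k) / 2"
    using F H by (simp add: case_prod_unfold)
  have le: "\<bar>std_normal_density v * (f (y + \<delta> * v) * h y)\<bar> \<le> ?d (v, y)" for v y
  proof -
    have "std_normal_density v * \<bar>f (y + \<delta> * v) * h y\<bar>
        \<le> std_normal_density v * ((k * (f (y + \<delta> * v))\<^sup>2 + (h y)\<^sup>2 / k) / 2)"
      by (intro mult_left_mono weighted_young \<open>0 < k\<close>) simp
    then show ?thesis by (simp add: abs_mult algebra_simps add_divide_distrib)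
  qed
  show int: "integrable (lborel \<Otimes>\<^sub>M lborel) (\<lambda>(v, y). std_normal_density v * (f (y + \<delta> * v) * h y))"
    by (rule Bochner_Integration.integrable_bound[OF d])
       (use le in \<open>auto simp del: abs_divide intro!: order_trans[OF _ abs_ge_self]\<close>)
  have "\<bar>gauss_corr f h \<delta>\<bar> \<le> (\<integral>p. ?d p \<partial>(lborel \<Otimes>\<^sub>M lborel))"
    unfolding gauss_corr_def real_norm_def[symmetric]
    by (rule Bochner_Integration.integral_norm_bound_integral[OF int d]) (use le in auto)
  then show "\<bar>gauss_corr f h \<delta>\<bar> \<le> (k * (\<integral>x. (f x)\<^sup>2 \<partial>lborel) + (\<integral>x. (h x)\<^sup>2 \<partial>lborel) / k) / 2"
    by (simp only: d_eq)
qed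

lemma abs_integral_product_le:
  fixes f h :: "real \<Rightarrow> real"
  assumes [measurable]: "f \<in> borel_measurable borel" "h \<in> borel_measurable borel"
    and "integrable lborel (\<lambda>x. (f x)\<^sup>2)" "integrable lborel (\<lambda>x. (h x)\<^sup>2)" "0 < k"
  shows "integrable lborel (\<lambda>x. f x * h x)"
    and "\<bar>\<integral>x. f x * h x \<partial>lborel\<bar> \<le> (k * (\<integral>x. (f x)\<^sup>2 \<partial>lborel) + (\<integral>x. (h x)\<^sup>2 \<partial>lborel) / k) / 2"
proof -
  have d: "integrable lborel (\<lambda>x. (k * (f x)\<^sup>2 + (h x)\<^sup>2 / k) / 2)"
    using assms by simp
  show int: "integrable lborel (\<lambda>x. f x * h x)"
    by (rule Bochner_Integration.integrable_bound[OF d])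
       (use weighted_young[OF \<open>0 < k\<close>] in \<open>auto simp del: abs_divide intro!: order_trans[OF _ abs_ge_self]\<close>)
  have "\<bar>\<integral>x. f x * h x \<partial>lborel\<bar> \<le> (\<integral>x. (k * (f x)\<^sup>2 + (h x)\<^sup>2 / k) / 2 \<partial>lborel)"
    unfolding real_norm_def[symmetric]
    by (rule Bochner_Integration.integral_norm_bound_integral[OF int d])
       (use weighted_young[OF \<open>0 < k\<close>] in auto)
  then show "\<bar>\<integral>x. f x * h x \<partial>lborel\<bar>
      \<le> (k * (\<integral>x. (f x)\<^sup>2 \<partial>lborel) + (\<integral>x. (h x)\<^sup>2 \<partial>lborel) / k) / 2"
    using assms by simp
qed

lemma gauss_corr_diff:
  assumes [measurable]: "f \<in> borel_measurable borel" "g \<in> borel_measurable borel"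
      "h \<in> borel_measurable borel"
    and "integrable lborel (\<lambda>x. (f x)\<^sup>2)" "integrable lborel (\<lambda>x. (g x)\<^sup>2)"
      "integrable lborel (\<lambda>x. (h x)\<^sup>2)"
  shows "gauss_corr (\<lambda>x. f x - g x) h \<delta> = gauss_corr f h \<delta> - gauss_corr g h \<delta>"
  using gauss_corr_bound(1)[of f h 1 \<delta>] gauss_corr_bound(1)[of g h 1 \<delta>] assms
  unfolding gauss_corr_def
  by (simp add: algebra_simps case_prod_unfold flip: Bochner_Integration.integral_diff)

lemma gauss_corr_tendsto_continuous:
  assumes g: "continuous_on UNIV g" "\<And>x. \<bar>g x\<bar> \<le> M"
    and h: "integrable lborel h" and \<delta>: "\<delta> \<longlonglongrightarrow> 0"
  shows "(\<lambda>n. gauss_corr g h (\<delta> n)) \<longlonglongrightarrow> (\<integral>x. g x * h x \<partial>lborel)"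
proof -
  have [measurable]: "h \<in> borel_measurable borel" "g \<in> borel_measurable borel"
    using borel_measurable_integrable[OF h] borel_measurable_continuous_onI[OF g(1)] by simp_all
  have le: "\<bar>s * (g x * k)\<bar> \<le> M * (norm s * norm k)" for s k x
    using mult_right_mono[OF g(2)[of x], of "\<bar>s\<bar> * \<bar>k\<bar>"] by (simp add: abs_mult mult_ac)
  have gauss: "integrable lborel std_normal_density" by simp
  have dom: "integrable (lborel \<Otimes>\<^sub>M lborel) (\<lambda>(v, y). M * (norm (std_normal_density v) * norm (h y)))"
    using integrable_pair_norm_product[OF gauss h] by (simp add: case_prod_unfold)
  have gh: "integrable (lborel \<Otimes>\<^sub>M lborel) (\<lambda>(v, y). std_normal_density v * (g y * h y))"
  proof (rule Bochner_Integration.integrable_bound[OF dom])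
    show "AE p in lborel \<Otimes>\<^sub>M lborel. norm (case p of (v, y) \<Rightarrow> std_normal_density v * (g y * h y))
        \<le> norm (case p of (v, y) \<Rightarrow> M * (norm (std_normal_density v) * norm (h y)))"
    proof (intro AE_I2)
      fix p :: "real \<times> real"
      show "norm (case p of (v, y) \<Rightarrow> std_normal_density v * (g y * h y))
          \<le> norm (case p of (v, y) \<Rightarrow> M * (norm (std_normal_density v) * norm (h y)))"
        using order_trans[OF le[of "std_normal_density (fst p)" "snd p" "h (snd p)"] abs_ge_self]
        by (simp add: case_prod_unfold)
    qed
  qed simp
  have "(\<lambda>n. gauss_corr g h (\<delta> n)) \<longlonglongrightarrow>
      (\<integral>(v, y). std_normal_density v * (g y * h y) \<partial>(lborel \<Otimes>\<^sub>M lborel))"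
    unfolding gauss_corr_def
  proof (rule integral_dominated_convergence[OF _ _ dom])
    have "(\<lambda>n. g (y + \<delta> n * v)) \<longlonglongrightarrow> g y" for v y
    proof -
      have "(\<lambda>n. y + \<delta> n * v) \<longlonglongrightarrow> y + 0 * v" by (intro tendsto_intros \<delta>)
      moreover have "isCont g y" using g(1) by (simp add: continuous_on_eq_continuous_at)
      ultimately show ?thesis using isCont_tendsto_compose[of y g] by simp
    qed
    then show "AE p in lborel \<Otimes>\<^sub>M lborel.
        (\<lambda>n. case p of (v, y) \<Rightarrow> std_normal_density v * (g (y + \<delta> n * v) * h y)) \<longlonglongrightarrow>
        (case p of (v, y) \<Rightarrow> std_normal_density v * (g y * h y))"
      by (intro AE_I2) (auto split: prod.split intro!: tendsto_intros)
    show "AE p in lborel \<Otimes>\<^sub>M lborel.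
        norm (case p of (v, y) \<Rightarrow> std_normal_density v * (g (y + \<delta> n * v) * h y))
          \<le> (case p of (v, y) \<Rightarrow> M * (norm (std_normal_density v) * norm (h y)))" for n
    proof (intro AE_I2)
      fix p :: "real \<times> real"
      show "norm (case p of (v, y) \<Rightarrow> std_normal_density v * (g (y + \<delta> n * v) * h y))
          \<le> (case p of (v, y) \<Rightarrow> M * (norm (std_normal_density v) * norm (h y)))"
        using le[of "std_normal_density (fst p)" "snd p + \<delta> n * fst p" "h (snd p)"]
        by (simp add: case_prod_unfold)
    qed
  qed simp_all
  also have "(\<integral>(v, y). std_normal_density v * (g y * h y) \<partial>(lborel \<Otimes>\<^sub>M lborel))
      = (\<integral>x. g x * h x \<partial>lborel)"
    using lborel_pair.integral_fst[OF gh] by simp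
  finally show ?thesis .
qed

text \<open>
  For continuous bounded \<open>f\<close> this is dominated convergence. The general case follows by density, because
  the bilinear form is bounded on \<open>L\<^sup>2\<close> uniformly in \<open>\<delta>\<close>.
\<close>

lemma gauss_corr_tendsto:
  assumes [measurable]: "f \<in> borel_measurable borel" and h: "integrable lborel h"
    and f2: "integrable lborel (\<lambda>x. (f x)\<^sup>2)" and h2: "integrable lborel (\<lambda>x. (h x)\<^sup>2)"
    and \<delta>: "\<delta> \<longlonglongrightarrow> 0"
  shows "(\<lambda>n. gauss_corr f h (\<delta> n)) \<longlonglongrightarrow> (\<integral>x. f x * h x \<partial>lborel)"
proof (rule LIMSEQ_I)
  fix e :: real assume "0 < e"
  have [measurable]: "h \<in> borel_measurable borel"
    using borel_measurable_integrable[OF h] by simp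
  define H where "H = (\<integral>x. (h x)\<^sup>2 \<partial>lborel)"
  have H: "0 \<le> H" by (simp add: H_def)
  \<comment> \<open>With \<open>f\<close> approximated up to \<open>d\<close> in \<open>L\<^sup>2\<close>, Young's inequality with weight \<open>1 / d\<close> bounds each of the
    two approximation errors by \<open>d (1 + H) / 2 = e / 4\<close>.\<close>
  define d where "d = e / (2 * (1 + H))"
  have "0 < d" using \<open>0 < e\<close> H by (simp add: d_def)
  have dH: "d * (1 + H) = e / 2" using H by (simp add: d_def field_simps)
  obtain g M where g: "continuous_on UNIV g" "\<And>x. \<bar>g x\<bar> \<le> M"
    and g2: "integrable lborel (\<lambda>x. (g x)\<^sup>2)" and fg: "(\<integral>x. (f x - g x)\<^sup>2 \<partial>lborel) < d\<^sup>2"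
    using continuous_bounded_dense_L2[of f "d\<^sup>2"] f2 \<open>0 < d\<close> by auto
  have [measurable]: "g \<in> borel_measurable borel"
    by (rule borel_measurable_continuous_onI[OF g(1)])
  have fg2: "integrable lborel (\<lambda>x. (f x - g x)\<^sup>2)"
    using f2 g2 abs_integral_product_le(1)[of f g 1]
    by (simp add: power2_diff mult.assoc)
  have small: "(1 / d * (\<integral>x. (f x - g x)\<^sup>2 \<partial>lborel) + H / (1 / d)) / 2 \<le> d * (1 + H) / 2"
  proof -
    have "1 / d * (\<integral>x. (f x - g x)\<^sup>2 \<partial>lborel) \<le> 1 / d * d\<^sup>2"
      using fg \<open>0 < d\<close> by (intro mult_left_mono) auto
    then show ?thesis using \<open>0 < d\<close> by (simp add: power2_eq_square algebra_simps)
  qed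
  have 1: "\<bar>gauss_corr f h (\<delta> n) - gauss_corr g h (\<delta> n)\<bar> \<le> e / 4" for n
  proof -
    have "\<bar>gauss_corr (\<lambda>x. f x - g x) h (\<delta> n)\<bar>
        \<le> (1 / d * (\<integral>x. (f x - g x)\<^sup>2 \<partial>lborel) + H / (1 / d)) / 2"
      unfolding H_def using \<open>0 < d\<close> by (intro gauss_corr_bound(2) fg2 h2) auto
    moreover have "gauss_corr (\<lambda>x. f x - g x) h (\<delta> n) = gauss_corr f h (\<delta> n) - gauss_corr g h (\<delta> n)"
      by (intro gauss_corr_diff f2 g2 h2) measurable
    ultimately show ?thesis using small dH by linarith
  qed
  have 2: "\<bar>(\<integral>x. f x * h x \<partial>lborel) - (\<integral>x. g x * h x \<partial>lborel)\<bar> \<le> e / 4"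
  proof -
    have "(\<integral>x. f x * h x \<partial>lborel) - (\<integral>x. g x * h x \<partial>lborel) = (\<integral>x. (f x - g x) * h x \<partial>lborel)"
      using abs_integral_product_le(1)[of f h 1] abs_integral_product_le(1)[of g h 1] f2 g2 h2
      by (simp add: left_diff_distrib)
    also have "\<bar>\<dots>\<bar> \<le> (1 / d * (\<integral>x. (f x - g x)\<^sup>2 \<partial>lborel) + H / (1 / d)) / 2"
      unfolding H_def using \<open>0 < d\<close> by (intro abs_integral_product_le(2) fg2 h2) auto
    finally show ?thesis using small dH by linarith
  qed
  obtain N where N: "\<And>n. N \<le> n \<Longrightarrow> \<bar>gauss_corr g h (\<delta> n) - (\<integral>x. g x * h x \<partial>lborel)\<bar> < e / 2"
    using LIMSEQ_D[OF gauss_corr_tendsto_continuous[OF g h \<delta>], of "e / 2"] \<open>0 < e\<close> by auto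
  have "norm (gauss_corr f h (\<delta> n) - (\<integral>x. f x * h x \<partial>lborel)) < e" if "N \<le> n" for n
    using 1[of n] 2 N[OF that] by (simp add: abs_if split: if_splits)
  then show "\<exists>N. \<forall>n\<ge>N. norm (gauss_corr f h (\<delta> n) - (\<integral>x. f x * h x \<partial>lborel)) < e" by blast
qed

section \<open>A Gaussian form of Parseval's identity\<close>

lemma integrable_gaussian:
  fixes \<delta> :: real
  assumes "0 < \<delta>"
  shows "integrable lborel (\<lambda>\<xi>. exp (- (\<delta> * \<xi>)\<^sup>2 / 2))"
proof -
  have "integrable lborel (\<lambda>\<xi>::real. sqrt (2 * pi) * std_normal_density (0 + \<delta> * \<xi>))"
    using assms by (intro integrable_mult_right lborel_integrable_real_affine) auto
  then show ?thesis by (simp add: std_normal_density_def)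
qed

lemma gaussian_cosine_transform:
  assumes "0 < \<delta>"
  shows "(\<integral>\<xi>. exp (- (\<delta> * \<xi>)\<^sup>2 / 2) * cos (\<xi> * u) \<partial>lborel) = 2 * pi / \<delta> * std_normal_density (u / \<delta>)"
proof -
  have "char std_normal_distribution (u / \<delta>) = (\<integral>v. std_normal_density v *\<^sub>R iexp (u / \<delta> * v) \<partial>lborel)"
    unfolding char_def by (intro integral_density) simp_all
  from arg_cong[OF this, of Re]
  have "exp (- (u / \<delta>)\<^sup>2 / 2) = Re (\<integral>v. std_normal_density v *\<^sub>R iexp (u / \<delta> * v) \<partial>lborel)"
    by (simp only: char_std_normal_distribution Re_complex_of_real)
  also have "\<dots> = (\<integral>v. Re (std_normal_density v *\<^sub>R iexp (u / \<delta> * v)) \<partial>lborel)"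
  proof (rule integral_Re[symmetric])
    show "complex_integrable lborel (\<lambda>v. std_normal_density v *\<^sub>R iexp (u / \<delta> * v))"
      by (rule Bochner_Integration.integrable_bound[where f = std_normal_density]) auto
  qed
  also have "\<dots> = (\<integral>v. (1 / sqrt (2 * pi)) * (exp (- v\<^sup>2 / 2) * cos (u / \<delta> * v)) \<partial>lborel)"
    by (intro Bochner_Integration.integral_cong refl) (simp add: std_normal_density_def Re_exp)
  also have "\<dots> = (1 / sqrt (2 * pi)) * (\<integral>v. exp (- v\<^sup>2 / 2) * cos (u / \<delta> * v) \<partial>lborel)"
    by (rule integral_mult_right_zero)
  also have "(\<integral>v. exp (- v\<^sup>2 / 2) * cos (u / \<delta> * v) \<partial>lborel)
      = \<delta> * (\<integral>\<xi>. exp (- (\<delta> * \<xi>)\<^sup>2 / 2) * cos (\<xi> * u) \<partial>lborel)"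
    using lborel_integral_real_affine[of \<delta> "\<lambda>v. exp (- v\<^sup>2 / 2) * cos (u / \<delta> * v)" 0] assms
    by (simp add: mult.commute)
  finally have *: "exp (- (u / \<delta>)\<^sup>2 / 2)
      = 1 / sqrt (2 * pi) * (\<delta> * (\<integral>\<xi>. exp (- (\<delta> * \<xi>)\<^sup>2 / 2) * cos (\<xi> * u) \<partial>lborel))" .
  have "2 * pi = sqrt (2 * pi) * sqrt (2 * pi)" by simp
  then show ?thesis
    using assms unfolding std_normal_density_def * by (simp add: field_simps)
qed

lemma inner_iexp: "iexp a \<bullet> iexp b = cos (a - b)"
  by (simp add: inner_complex_def Re_exp Im_exp cos_diff)

text \<open>
  Write the inner product of the two transforms as a double integral over \<open>(x, y)\<close>, integrate the
  Gaussian in \<open>\<xi>\<close> first, and substitute \<open>x = y + \<delta> v\<close>. The Gaussian factor is what makes the triple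
  integral absolutely convergent.
\<close>

lemma gaussian_parseval:
  fixes f h :: "real \<Rightarrow> real"
  assumes f: "integrable lborel f" and h: "integrable lborel h"
    and f2: "integrable lborel (\<lambda>x. (f x)\<^sup>2)" and h2: "integrable lborel (\<lambda>x. (h x)\<^sup>2)"
    and "0 < \<delta>"
  shows "(\<integral>\<xi>. exp (- (\<delta> * \<xi>)\<^sup>2 / 2) *
      ((\<integral>x. f x *\<^sub>R iexp (\<xi> * x) \<partial>lborel) \<bullet> (\<integral>y. h y *\<^sub>R iexp (\<xi> * y) \<partial>lborel)) \<partial>lborel)
    = 2 * pi * gauss_corr f h \<delta>"
proof -
  interpret P: pair_sigma_finite lborel "lborel \<Otimes>\<^sub>M (lborel :: real measure)"
    unfolding lborel_prod ..
  have [measurable]: "f \<in> borel_measurable borel" "h \<in> borel_measurable borel"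
    using borel_measurable_integrable[OF f] borel_measurable_integrable[OF h] by simp_all
  define G where "G \<xi> = exp (- (\<delta> * \<xi>)\<^sup>2 / 2)" for \<xi>
  have [measurable]: "G \<in> borel_measurable borel" unfolding G_def[abs_def] by measurable
  have G_int: "integrable lborel G"
    unfolding G_def[abs_def] using \<open>0 < \<delta>\<close> by (rule integrable_gaussian)
  define K where "K \<xi> p = G \<xi> * (f (fst p) * h (snd p) * cos (\<xi> * (fst p - snd p)))" for \<xi> p
  have fh: "integrable (lborel \<Otimes>\<^sub>M lborel) (\<lambda>(x, y). norm (f x) * norm (h y))"
    by (rule integrable_pair_norm_product[OF f h])
  have fh_cos: "integrable (lborel \<Otimes>\<^sub>M lborel) (\<lambda>(x, y). f x * h y * cos (\<xi> * (x - y)))" for \<xi>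
    by (rule Bochner_Integration.integrable_bound[OF fh])
       (auto simp: abs_mult intro!: AE_I2 mult_left_le split: prod.split)
  have K_int: "integrable (lborel \<Otimes>\<^sub>M (lborel \<Otimes>\<^sub>M lborel)) (case_prod K)"
  proof (rule P.Fubini_integrable)
    show "case_prod K \<in> borel_measurable (lborel \<Otimes>\<^sub>M (lborel \<Otimes>\<^sub>M lborel))"
      unfolding K_def by measurable
    show "AE \<xi> in lborel. integrable (lborel \<Otimes>\<^sub>M lborel) (\<lambda>p. case_prod K (\<xi>, p))"
      using fh_cos by (simp add: K_def case_prod_unfold)
    show "integrable lborel (\<lambda>\<xi>. \<integral>p. norm (case_prod K (\<xi>, p)) \<partial>(lborel \<Otimes>\<^sub>M lborel))"
    proof (rule Bochner_Integration.integrable_bound)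
      let ?I = "\<integral>(x, y). norm (f x) * norm (h y) \<partial>(lborel \<Otimes>\<^sub>M lborel)"
      show "integrable lborel (\<lambda>\<xi>. G \<xi> * ?I)" using G_int by simp
      show "(\<lambda>\<xi>. \<integral>p. norm (case_prod K (\<xi>, p)) \<partial>(lborel \<Otimes>\<^sub>M lborel)) \<in> borel_measurable lborel"
        unfolding K_def by measurable
      have "(\<integral>p. norm (K \<xi> p) \<partial>(lborel \<Otimes>\<^sub>M lborel)) \<le> G \<xi> * ?I" for \<xi>
      proof -
        have "(\<integral>p. norm (K \<xi> p) \<partial>(lborel \<Otimes>\<^sub>M lborel))
            \<le> (\<integral>p. G \<xi> * (case p of (x, y) \<Rightarrow> norm (f x) * norm (h y)) \<partial>(lborel \<Otimes>\<^sub>M lborel))"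
        proof (rule integral_mono')
          show "integrable (lborel \<Otimes>\<^sub>M lborel) (\<lambda>p. G \<xi> * (case p of (x, y) \<Rightarrow> norm (f x) * norm (h y)))"
            by (intro integrable_mult_right fh)
          show "norm (K \<xi> p) \<le> G \<xi> * (case p of (x, y) \<Rightarrow> norm (f x) * norm (h y))" for p
            by (auto simp: K_def G_def abs_mult split: prod.split intro!: mult_left_mono mult_left_le)
        qed (auto simp: G_def split: prod.split)
        then show ?thesis by simp
      qed
      then show "AE \<xi> in lborel. norm (\<integral>p. norm (case_prod K (\<xi>, p)) \<partial>(lborel \<Otimes>\<^sub>M lborel)) \<le> norm (G \<xi> * ?I)"
        by (intro AE_I2) (auto intro: order_trans[OF _ abs_ge_self])
    qed
  qed
  have K_transform: "(\<lambda>p. \<integral>\<xi>. K \<xi> p \<partial>lborel)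
      = (\<lambda>(x, y). f x * h y * (2 * pi / \<delta> * std_normal_density ((x - y) / \<delta>)))"
  proof (rule ext)
    fix p :: "real \<times> real"
    have "(\<integral>\<xi>. K \<xi> p \<partial>lborel)
        = (\<integral>\<xi>. (f (fst p) * h (snd p)) * (exp (- (\<delta> * \<xi>)\<^sup>2 / 2) * cos (\<xi> * (fst p - snd p))) \<partial>lborel)"
      by (intro Bochner_Integration.integral_cong refl) (simp add: K_def G_def)
    then show "(\<integral>\<xi>. K \<xi> p \<partial>lborel)
        = (case p of (x, y) \<Rightarrow> f x * h y * (2 * pi / \<delta> * std_normal_density ((x - y) / \<delta>)))"
      by (simp only: integral_mult_right_zero gaussian_cosine_transform[OF \<open>0 < \<delta>\<close>] case_prod_unfold)
  qed
  have "(\<integral>\<xi>. G \<xi> * ((\<integral>x. f x *\<^sub>R iexp (\<xi> * x) \<partial>lborel) \<bullet> (\<integral>y. h y *\<^sub>R iexp (\<xi> * y) \<partial>lborel)) \<partial>lborel)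
      = (\<integral>\<xi>. \<integral>p. K \<xi> p \<partial>(lborel \<Otimes>\<^sub>M lborel) \<partial>lborel)"
  proof (intro Bochner_Integration.integral_cong refl)
    fix \<xi> :: real
    have e: "integrable lborel (\<lambda>x. u x *\<^sub>R iexp (\<xi> * x))" if "integrable lborel u" for u :: "real \<Rightarrow> real"
      by (rule Bochner_Integration.integrable_bound[OF that])
         (use borel_measurable_integrable[OF that] in auto)
    have "(\<integral>x. f x *\<^sub>R iexp (\<xi> * x) \<partial>lborel) \<bullet> (\<integral>y. h y *\<^sub>R iexp (\<xi> * y) \<partial>lborel)
        = (\<integral>x. \<integral>y. (f x *\<^sub>R iexp (\<xi> * x)) \<bullet> (h y *\<^sub>R iexp (\<xi> * y)) \<partial>lborel \<partial>lborel)"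
      using e[OF f] e[OF h] by (simp del: inner_scaleR_left inner_scaleR_right)
    also have "\<dots> = (\<integral>x. \<integral>y. f x * h y * cos (\<xi> * (x - y)) \<partial>lborel \<partial>lborel)"
      by (simp only: inner_scaleR_left inner_scaleR_right inner_iexp of_real_mult[symmetric]
          right_diff_distrib mult_ac)
    also have "\<dots> = (\<integral>(x, y). f x * h y * cos (\<xi> * (x - y)) \<partial>(lborel \<Otimes>\<^sub>M lborel))"
      by (rule lborel_pair.integral_fst[OF fh_cos])
    finally show "G \<xi> * ((\<integral>x. f x *\<^sub>R iexp (\<xi> * x) \<partial>lborel) \<bullet> (\<integral>y. h y *\<^sub>R iexp (\<xi> * y) \<partial>lborel))
        = (\<integral>p. K \<xi> p \<partial>(lborel \<Otimes>\<^sub>M lborel))"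
      by (simp add: K_def case_prod_unfold)
  qed
  also have "\<dots> = (\<integral>p. \<integral>\<xi>. K \<xi> p \<partial>lborel \<partial>(lborel \<Otimes>\<^sub>M lborel))"
    by (rule P.Fubini_integral[OF K_int, symmetric])
  also have "\<dots> = (\<integral>(x, y). f x * h y * (2 * pi / \<delta> * std_normal_density ((x - y) / \<delta>)) \<partial>(lborel \<Otimes>\<^sub>M lborel))"
    by (simp only: K_transform)
  also have "\<dots> = (\<integral>y. \<integral>x. f x * h y * (2 * pi / \<delta> * std_normal_density ((x - y) / \<delta>)) \<partial>lborel \<partial>lborel)"
    by (rule lborel_pair.integral_snd[symmetric]) (use P.integrable_snd[OF K_int] in \<open>simp only: K_transform\<close>)
  also have "\<dots> = (\<integral>y. 2 * pi * (\<integral>v. std_normal_density v * (f (y + \<delta> * v) * h y) \<partial>lborel) \<partial>lborel)"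
  proof (intro Bochner_Integration.integral_cong refl)
    fix y :: real
    have "(\<integral>x. f x * h y * (2 * pi / \<delta> * std_normal_density ((x - y) / \<delta>)) \<partial>lborel)
        = \<delta> * (\<integral>v. f (y + \<delta> * v) * h y * (2 * pi / \<delta> * std_normal_density v) \<partial>lborel)"
      using lborel_integral_real_affine[of \<delta>
          "\<lambda>x. f x * h y * (2 * pi / \<delta> * std_normal_density ((x - y) / \<delta>))" y] \<open>0 < \<delta>\<close> by simp
    also have "\<dots> = (\<integral>v. 2 * pi * (std_normal_density v * (f (y + \<delta> * v) * h y)) \<partial>lborel)"
      unfolding integral_mult_right_zero[symmetric]
      using \<open>0 < \<delta>\<close> by (intro Bochner_Integration.integral_cong refl) simp
    finally show "(\<integral>x. f x * h y * (2 * pi / \<delta> * std_normal_density ((x - y) / \<delta>)) \<partial>lborel)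
        = 2 * pi * (\<integral>v. std_normal_density v * (f (y + \<delta> * v) * h y) \<partial>lborel)"
      by (simp only: integral_mult_right_zero)
  qed
  also have "\<dots> = 2 * pi * gauss_corr f h \<delta>"
    using lborel_pair.integral_snd[OF gauss_corr_bound(1)[of f h 1 \<delta>]] f2 h2
    by (simp add: gauss_corr_def)
  finally show ?thesis by (simp only: G_def)
qed

section \<open>The energy argument\<close>

text \<open>
  The comparison with \<open>1 / (1 + \<xi>\<^sup>2)\<close>, uniform in \<open>\<epsilon> \<le> 1\<close>, serves both for integrability and as the
  dominating function for \<open>\<epsilon> \<rightarrow> 0\<close>.
\<close>

lemma integrable_resolvent:
  assumes "0 < \<epsilon>" "\<epsilon> \<le> 1"
  shows "integrable lborel (\<lambda>\<xi>::real. 1 / (\<epsilon> + \<xi>\<^sup>2))"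
    and "\<epsilon> / (\<epsilon> + \<xi>\<^sup>2) \<le> 1 / (1 + \<xi>\<^sup>2)"
proof -
  show le: "\<epsilon> / (\<epsilon> + \<xi>\<^sup>2) \<le> 1 / (1 + \<xi>\<^sup>2)" for \<xi> :: real
  proof (rule frac_le_eq[THEN iffD2])
    show "\<epsilon> + \<xi>\<^sup>2 \<noteq> 0" "1 + \<xi>\<^sup>2 \<noteq> 0"
      using assms by (smt (verit) zero_le_power2)+
    have "\<epsilon> * (1 + \<xi>\<^sup>2) - 1 * (\<epsilon> + \<xi>\<^sup>2) \<le> 0"
      using assms mult_left_le_one_le[of "\<xi>\<^sup>2" \<epsilon>] by (simp add: algebra_simps)
    moreover have "0 < (\<epsilon> + \<xi>\<^sup>2) * (1 + \<xi>\<^sup>2)"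
      using assms by (intro mult_pos_pos add_pos_nonneg) auto
    ultimately show "(\<epsilon> * (1 + \<xi>\<^sup>2) - 1 * (\<epsilon> + \<xi>\<^sup>2)) / ((\<epsilon> + \<xi>\<^sup>2) * (1 + \<xi>\<^sup>2)) \<le> 0"
      by (simp add: divide_le_0_iff)
  qed
  have "integrable lborel (\<lambda>\<xi>::real. \<epsilon> / (\<epsilon> + \<xi>\<^sup>2))"
  proof (rule Bochner_Integration.integrable_bound[OF integrable_inverse_one_plus_square])
    show "AE \<xi> in lborel. norm (\<epsilon> / (\<epsilon> + \<xi>\<^sup>2)) \<le> norm (1 / (1 + \<xi>\<^sup>2))"
      using le assms by (intro AE_I2) (simp add: abs_of_nonneg add_nonneg_nonneg)
  qed simp
  from integrable_mult_right[OF this, of "1 / \<epsilon>"] assms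
  show "integrable lborel (\<lambda>\<xi>::real. 1 / (\<epsilon> + \<xi>\<^sup>2))" by simp
qed

lemma resolvent_mass_tendsto_0:
  "(\<lambda>n. \<integral>\<xi>. (1 / real (Suc n)) / (1 / real (Suc n) + \<xi>\<^sup>2) \<partial>lborel) \<longlonglongrightarrow> 0"
proof -
  have "(\<lambda>n. \<integral>\<xi>. (1 / real (Suc n)) / (1 / real (Suc n) + \<xi>\<^sup>2) \<partial>lborel)
      \<longlonglongrightarrow> (\<integral>\<xi>. 0 \<partial>(lborel :: real measure))"
  proof (rule integral_dominated_convergence[where w = "\<lambda>\<xi>. 1 / (1 + \<xi>\<^sup>2)"])
    have inv: "(\<lambda>n. 1 / real (Suc n)) \<longlonglongrightarrow> 0"
      using LIMSEQ_inverse_real_of_nat by (simp add: inverse_eq_divide)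
    show "AE \<xi> in lborel. (\<lambda>n. (1 / real (Suc n)) / (1 / real (Suc n) + \<xi>\<^sup>2)) \<longlonglongrightarrow> 0"
      using AE_lborel_singleton[of 0]
    proof eventually_elim
      case (elim \<xi>)
      have "(\<lambda>n. (1 / real (Suc n)) / (1 / real (Suc n) + \<xi>\<^sup>2)) \<longlonglongrightarrow> 0 / (0 + \<xi>\<^sup>2)"
        using elim by (intro tendsto_divide tendsto_add inv tendsto_const) auto
      then show ?case by simp
    qed
    show "AE \<xi> in lborel. norm ((1 / real (Suc n)) / (1 / real (Suc n) + \<xi>\<^sup>2)) \<le> 1 / (1 + \<xi>\<^sup>2)" for n
    proof (intro AE_I2)
      fix \<xi> :: real
      have "0 \<le> (1 / real (Suc n)) / (1 / real (Suc n) + \<xi>\<^sup>2)"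
        by (intro divide_nonneg_nonneg add_nonneg_nonneg) auto
      with integrable_resolvent(2)[of "1 / real (Suc n)" \<xi>]
      show "norm ((1 / real (Suc n)) / (1 / real (Suc n) + \<xi>\<^sup>2)) \<le> 1 / (1 + \<xi>\<^sup>2)" by simp
    qed
  qed (use integrable_inverse_one_plus_square in simp_all)
  then show ?thesis by simp
qed

text \<open>
  The diffusion equation on the Fourier side: \<open>Z t\<close> is the transform of the difference of the two
  solutions and \<open>W t\<close> the transform of its product with the coefficient.
\<close>

locale fourier_evolution =
  fixes W Z :: "real \<Rightarrow> real \<Rightarrow> complex" and C T :: real
  assumes W_measurable [measurable]: "case_prod W \<in> borel_measurable (borel \<Otimes>\<^sub>M borel)"
    and Z_measurable [measurable]: "case_prod Z \<in> borel_measurable (borel \<Otimes>\<^sub>M borel)"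
    and W_le: "norm (W s \<xi>) \<le> C" and Z_le: "norm (Z s \<xi>) \<le> C"
    and evolution: "t \<in> {0..T} \<Longrightarrow> Z t \<xi> = - (\<xi>\<^sup>2 *\<^sub>R (LBINT s:{0..t}. W s \<xi>))"
begin

lemma C_nonneg: "0 \<le> C"
  using W_le[of 0 0] norm_ge_zero order_trans by blast

lemma inner_le: "\<bar>W s \<xi> \<bullet> Z s \<xi>\<bar> \<le> C\<^sup>2"
  using Cauchy_Schwarz_ineq2[of "W s \<xi>" "Z s \<xi>"] mult_mono[OF W_le[of s \<xi>] Z_le[of s \<xi>] C_nonneg norm_ge_zero]
  by (simp add: power2_eq_square)

lemma power_diff:
  assumes "0 \<le> \<kappa>" "\<kappa> \<le> t" "t \<le> T"
  shows "(norm (Z t \<xi>))\<^sup>2 - (norm (Z \<kappa> \<xi>))\<^sup>2 = - (2 * \<xi>\<^sup>2 * (LBINT s:{\<kappa>..t}. W s \<xi> \<bullet> Z s \<xi>))"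
proof -
  let ?F = "\<lambda>t. LBINT s:{0..t}. W s \<xi>"
  have "(LBINT s:{\<kappa>..t}. W s \<xi> \<bullet> Z s \<xi>) = (LBINT s:{\<kappa>..t}. - \<xi>\<^sup>2 * (W s \<xi> \<bullet> ?F s))"
    using assms by (intro set_lebesgue_integral_cong) (auto simp: evolution)
  then have "(LBINT s:{\<kappa>..t}. W s \<xi> \<bullet> Z s \<xi>) = - \<xi>\<^sup>2 * (LBINT s:{\<kappa>..t}. W s \<xi> \<bullet> ?F s)"
    by (simp only: set_integral_mult_right)
  moreover have "(norm (?F t))\<^sup>2 - (norm (?F \<kappa>))\<^sup>2 = 2 * (LBINT s:{\<kappa>..t}. W s \<xi> \<bullet> ?F s)"
    by (rule norm_primitive_square_diff) (use assms W_le in auto)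
  moreover have "(norm (Z s \<xi>))\<^sup>2 = (\<xi>\<^sup>2)\<^sup>2 * (norm (?F s))\<^sup>2" if "s \<in> {0..T}" for s
    using that by (simp add: evolution power_mult_distrib)
  ultimately show ?thesis
    using assms by (simp add: algebra_simps power2_eq_square flip: right_diff_distrib)
qed

lemma dissipation_Fubini:
  assumes "0 < \<delta>"
  shows "(\<integral>\<xi>. exp (- (\<delta> * \<xi>)\<^sup>2 / 2) * (LBINT s:{\<kappa>..t}. W s \<xi> \<bullet> Z s \<xi>) \<partial>lborel)
    = (LBINT s:{\<kappa>..t}. (\<integral>\<xi>. exp (- (\<delta> * \<xi>)\<^sup>2 / 2) * (W s \<xi> \<bullet> Z s \<xi>) \<partial>lborel))"
proof -
  let ?k = "\<lambda>\<xi> s. exp (- (\<delta> * \<xi>)\<^sup>2 / 2) * (indicator {\<kappa>..t} s * (W s \<xi> \<bullet> Z s \<xi>))"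
  have dom: "integrable (lborel \<Otimes>\<^sub>M lborel)
      (\<lambda>(\<xi>, s). C\<^sup>2 * (norm (exp (- (\<delta> * \<xi>)\<^sup>2 / 2)) * norm (indicat_real {\<kappa>..t} s)))"
    using integrable_pair_norm_product[OF integrable_gaussian[OF assms] integrable_indicator_Icc]
    by (simp add: case_prod_unfold)
  have int: "integrable (lborel \<Otimes>\<^sub>M lborel) (case_prod ?k)"
  proof (rule Bochner_Integration.integrable_bound[OF dom])
    show "case_prod ?k \<in> borel_measurable (lborel \<Otimes>\<^sub>M lborel)" by measurable
    show "AE p in lborel \<Otimes>\<^sub>M lborel. norm (case_prod ?k p) \<le>
        norm (case p of (\<xi>, s) \<Rightarrow> C\<^sup>2 * (norm (exp (- (\<delta> * \<xi>)\<^sup>2 / 2)) * norm (indicat_real {\<kappa>..t} s)))"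
      using inner_le by (intro AE_I2) (auto simp: abs_mult mult_ac split: prod.split split_indicator)
  qed
  have "(\<integral>\<xi>. exp (- (\<delta> * \<xi>)\<^sup>2 / 2) * (LBINT s:{\<kappa>..t}. W s \<xi> \<bullet> Z s \<xi>) \<partial>lborel)
      = (\<integral>\<xi>. \<integral>s. ?k \<xi> s \<partial>lborel \<partial>lborel)"
    by (simp add: set_lebesgue_integral_def)
  also have "\<dots> = (\<integral>s. \<integral>\<xi>. ?k \<xi> s \<partial>lborel \<partial>lborel)"
    by (rule lborel_pair.Fubini_integral[OF int, symmetric])
  also have "\<dots> = (LBINT s:{\<kappa>..t}. (\<integral>\<xi>. exp (- (\<delta> * \<xi>)\<^sup>2 / 2) * (W s \<xi> \<bullet> Z s \<xi>) \<partial>lborel))"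
    unfolding set_lebesgue_integral_def
    by (intro Bochner_Integration.integral_cong refl) (simp split: split_indicator)
  finally show ?thesis .
qed

text \<open>
  This is \<open>power_diff\<close> integrated against \<open>exp (- (\<delta> \<xi>)\<^sup>2 / 2) / (\<epsilon> + \<xi>\<^sup>2)\<close>. The weight on the left
  is a lower bound of that multiplier for all \<open>\<delta>, \<epsilon> \<le> 1\<close>, so that the left side does not change when
  the parameters tend to 0.
\<close>

lemma energy_inequality:
  assumes "0 \<le> \<kappa>" "\<kappa> \<le> t" "t \<le> T" "0 < \<epsilon>" "\<epsilon> \<le> 1" "0 < \<delta>" "\<delta> \<le> 1"
  shows "(\<integral>\<xi>. exp (- \<xi>\<^sup>2 / 2) / (1 + \<xi>\<^sup>2) * (norm (Z t \<xi>))\<^sup>2 \<partial>lborel)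
    \<le> (\<integral>\<xi>. (norm (Z \<kappa> \<xi>))\<^sup>2 / (\<epsilon> + \<xi>\<^sup>2) \<partial>lborel)
      - 2 * (LBINT s:{\<kappa>..t}. (\<integral>\<xi>. exp (- (\<delta> * \<xi>)\<^sup>2 / 2) * (W s \<xi> \<bullet> Z s \<xi>) \<partial>lborel))
      + 2 * (C\<^sup>2 * T) * (\<integral>\<xi>. \<epsilon> / (\<epsilon> + \<xi>\<^sup>2) \<partial>lborel)"
proof -
  define G where "G \<xi> = exp (- (\<delta> * \<xi>)\<^sup>2 / 2)" for \<xi>
  define q where "q \<xi> = (LBINT s:{\<kappa>..t}. W s \<xi> \<bullet> Z s \<xi>)" for \<xi>
  have [measurable]: "G \<in> borel_measurable borel" unfolding G_def[abs_def] by measurable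
  have [measurable]: "q \<in> borel_measurable borel"
    unfolding q_def[abs_def] set_lebesgue_integral_def by measurable
  have q_le: "\<bar>q \<xi>\<bar> \<le> C\<^sup>2 * T" for \<xi>
  proof -
    have dom: "integrable lborel (\<lambda>s. C\<^sup>2 * indicat_real {\<kappa>..t} s)"
      by (intro integrable_mult_right integrable_indicator_Icc)
    have le: "\<bar>indicat_real {\<kappa>..t} s *\<^sub>R (W s \<xi> \<bullet> Z s \<xi>)\<bar> \<le> C\<^sup>2 * indicat_real {\<kappa>..t} s" for s
      using inner_le by (simp split: split_indicator)
    have "\<bar>q \<xi>\<bar> \<le> (\<integral>s. C\<^sup>2 * indicat_real {\<kappa>..t} s \<partial>lborel)"
      unfolding q_def set_lebesgue_integral_def real_norm_def[symmetric]
    proof (rule Bochner_Integration.integral_norm_bound_integral[OF _ dom])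
      show "integrable lborel (\<lambda>s. indicat_real {\<kappa>..t} s *\<^sub>R (W s \<xi> \<bullet> Z s \<xi>))"
        by (rule Bochner_Integration.integrable_bound[OF dom])
           (use le in \<open>auto intro!: AE_I2 order_trans[OF _ abs_ge_self] simp del: abs_mult\<close>)
    qed (use le in simp)
    also have "\<dots> = C\<^sup>2 * (t - \<kappa>)" using assms by simp
    also have "\<dots> \<le> C\<^sup>2 * T" using assms by (intro mult_left_mono) auto
    finally show ?thesis .
  qed
  have G: "0 \<le> G \<xi>" "G \<xi> \<le> 1" "exp (- \<xi>\<^sup>2 / 2) \<le> G \<xi>" for \<xi>
  proof -
    show "0 \<le> G \<xi>" "G \<xi> \<le> 1" by (simp_all add: G_def)
    have "(\<delta> * \<xi>)\<^sup>2 \<le> \<xi>\<^sup>2"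
      using assms by (simp add: power_mult_distrib mult_left_le_one_le power_le_one)
    then show "exp (- \<xi>\<^sup>2 / 2) \<le> G \<xi>" by (simp add: G_def)
  qed
  have pos: "0 < \<epsilon> + \<xi>\<^sup>2" for \<xi> :: real using assms by (simp add: add_pos_nonneg)
  have GI: "integrable lborel G" unfolding G_def[abs_def] by (rule integrable_gaussian) fact
  note R = integrable_resolvent[OF assms(4,5)]
  have Gq: "integrable lborel (\<lambda>\<xi>. G \<xi> * q \<xi>)"
  proof (rule Bochner_Integration.integrable_bound)
    show "integrable lborel (\<lambda>\<xi>. G \<xi> * (C\<^sup>2 * T))" using GI by simp
    show "AE \<xi> in lborel. norm (G \<xi> * q \<xi>) \<le> norm (G \<xi> * (C\<^sup>2 * T))"
      using G(1) q_le assms by (intro AE_I2) (auto simp: abs_mult intro!: mult_left_mono)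
  qed simp
  have RZ: "integrable lborel (\<lambda>\<xi>. (norm (Z s \<xi>))\<^sup>2 / (\<epsilon> + \<xi>\<^sup>2))" for s
  proof (rule Bochner_Integration.integrable_bound)
    show "integrable lborel (\<lambda>\<xi>. C\<^sup>2 * (1 / (\<epsilon> + \<xi>\<^sup>2)))" by (intro integrable_mult_right R(1))
    show "AE \<xi> in lborel. norm ((norm (Z s \<xi>))\<^sup>2 / (\<epsilon> + \<xi>\<^sup>2)) \<le> norm (C\<^sup>2 * (1 / (\<epsilon> + \<xi>\<^sup>2)))"
    proof (intro AE_I2)
      fix \<xi>
      have "(norm (Z s \<xi>))\<^sup>2 \<le> C\<^sup>2" using Z_le[of s \<xi>] by (intro power_mono) auto
      then show "norm ((norm (Z s \<xi>))\<^sup>2 / (\<epsilon> + \<xi>\<^sup>2)) \<le> norm (C\<^sup>2 * (1 / (\<epsilon> + \<xi>\<^sup>2)))"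
        using pos[of \<xi>] by (simp add: divide_right_mono abs_of_pos)
    qed
  qed simp
  have Re: "integrable lborel (\<lambda>\<xi>::real. \<epsilon> / (\<epsilon> + \<xi>\<^sup>2))"
    using integrable_mult_right[OF R(1), of \<epsilon>] by simp
  let ?rhs = "\<lambda>\<xi>. (norm (Z \<kappa> \<xi>))\<^sup>2 / (\<epsilon> + \<xi>\<^sup>2) - 2 * (G \<xi> * q \<xi>) + 2 * (C\<^sup>2 * T) * (\<epsilon> / (\<epsilon> + \<xi>\<^sup>2))"
  have le: "exp (- \<xi>\<^sup>2 / 2) / (1 + \<xi>\<^sup>2) * (norm (Z t \<xi>))\<^sup>2 \<le> ?rhs \<xi>" for \<xi>
  proof -
    have "exp (- \<xi>\<^sup>2 / 2) / (1 + \<xi>\<^sup>2) \<le> G \<xi> / (\<epsilon> + \<xi>\<^sup>2)"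
      using G assms pos[of \<xi>] by (intro frac_le) auto
    then have "exp (- \<xi>\<^sup>2 / 2) / (1 + \<xi>\<^sup>2) * (norm (Z t \<xi>))\<^sup>2 \<le> G \<xi> / (\<epsilon> + \<xi>\<^sup>2) * (norm (Z t \<xi>))\<^sup>2"
      by (intro mult_right_mono) auto
    also have "\<dots> = G \<xi> * ((norm (Z \<kappa> \<xi>))\<^sup>2 / (\<epsilon> + \<xi>\<^sup>2)) - 2 * (G \<xi> * q \<xi>)
        + 2 * (G \<xi> * q \<xi>) * (\<epsilon> / (\<epsilon> + \<xi>\<^sup>2))"
    proof -
      have Zt: "(norm (Z t \<xi>))\<^sup>2 = (norm (Z \<kappa> \<xi>))\<^sup>2 - 2 * \<xi>\<^sup>2 * q \<xi>"
        using power_diff[OF assms(1-3), of \<xi>] by (simp add: q_def)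
      have "g / d * (N - 2 * (d - \<epsilon>) * r) = g * (N / d) - 2 * (g * r) + 2 * (g * r) * (\<epsilon> / d)"
        if "d \<noteq> 0" for g d N r :: real
        using that by (simp add: field_simps)
      from this[of "\<epsilon> + \<xi>\<^sup>2" "G \<xi>" "(norm (Z \<kappa> \<xi>))\<^sup>2" "q \<xi>"] pos[of \<xi>]
      show ?thesis unfolding Zt by simp
    qed
    also have "\<dots> \<le> ?rhs \<xi>"
    proof (intro add_mono diff_mono order_refl)
      show "G \<xi> * ((norm (Z \<kappa> \<xi>))\<^sup>2 / (\<epsilon> + \<xi>\<^sup>2)) \<le> (norm (Z \<kappa> \<xi>))\<^sup>2 / (\<epsilon> + \<xi>\<^sup>2)"
        using G[of \<xi>] pos[of \<xi>] by (intro mult_left_le_one_le) auto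
      have "G \<xi> * q \<xi> \<le> 1 * (C\<^sup>2 * T)"
        using G[of \<xi>] q_le[of \<xi>] by (intro order_trans[OF mult_left_mono[of "q \<xi>" "C\<^sup>2 * T" "G \<xi>"]] mult_right_mono) auto
      then show "2 * (G \<xi> * q \<xi>) * (\<epsilon> / (\<epsilon> + \<xi>\<^sup>2)) \<le> 2 * (C\<^sup>2 * T) * (\<epsilon> / (\<epsilon> + \<xi>\<^sup>2))"
        using pos[of \<xi>] assms by (intro mult_right_mono) auto
    qed
    finally show ?thesis .
  qed
  have nonneg: "0 \<le> exp (- \<xi>\<^sup>2 / 2) / (1 + \<xi>\<^sup>2) * (norm (Z t \<xi>))\<^sup>2" for \<xi>
    by (intro mult_nonneg_nonneg divide_nonneg_nonneg add_nonneg_nonneg) auto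
  have int_rhs: "integrable lborel ?rhs"
    by (intro Bochner_Integration.integrable_add Bochner_Integration.integrable_diff
        integrable_mult_right RZ Gq Re)
  have "(\<integral>\<xi>. exp (- \<xi>\<^sup>2 / 2) / (1 + \<xi>\<^sup>2) * (norm (Z t \<xi>))\<^sup>2 \<partial>lborel) \<le> (\<integral>\<xi>. ?rhs \<xi> \<partial>lborel)"
    by (rule integral_mono'[OF int_rhs le order_trans[OF nonneg le]])
  also have "\<dots> = (\<integral>\<xi>. (norm (Z \<kappa> \<xi>))\<^sup>2 / (\<epsilon> + \<xi>\<^sup>2) \<partial>lborel) - 2 * (\<integral>\<xi>. G \<xi> * q \<xi> \<partial>lborel)
      + 2 * (C\<^sup>2 * T) * (\<integral>\<xi>. \<epsilon> / (\<epsilon> + \<xi>\<^sup>2) \<partial>lborel)"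
    using RZ Gq Re
    by (simp add: integrable_mult_right Bochner_Integration.integral_add Bochner_Integration.integral_diff
        del: integral_divide_zero times_divide_eq_right)
  also have "(\<integral>\<xi>. G \<xi> * q \<xi> \<partial>lborel)
      = (LBINT s:{\<kappa>..t}. (\<integral>\<xi>. exp (- (\<delta> * \<xi>)\<^sup>2 / 2) * (W s \<xi> \<bullet> Z s \<xi>) \<partial>lborel))"
    unfolding G_def q_def by (rule dissipation_Fubini) fact
  finally show ?thesis .
qed

text \<open>
  The inequality \<open>step1\<close> is the limit \<open>\<delta> \<rightarrow> 0\<close> of \<open>energy_inequality\<close> and \<open>step2\<close> is the limit
  \<open>\<kappa> \<rightarrow> 0\<close> of \<open>step1\<close>.
\<close>

lemma dissipative_imp_zero:
  assumes cont: "\<And>t. continuous_on UNIV (Z t)"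
    and dissip: "\<And>\<kappa> t e. 0 < \<kappa> \<Longrightarrow> \<kappa> \<le> t \<Longrightarrow> t \<le> T \<Longrightarrow> 0 < e \<Longrightarrow> \<exists>\<delta>>0. \<delta> \<le> 1 \<and>
      - e \<le> (LBINT s:{\<kappa>..t}. (\<integral>\<xi>. exp (- (\<delta> * \<xi>)\<^sup>2 / 2) * (W s \<xi> \<bullet> Z s \<xi>) \<partial>lborel))"
    and t: "t \<in> {0..T}"
  shows "Z t \<xi> = 0"
proof (cases "t = 0")
  case True
  have "(LBINT s:{0..0}. W s \<xi>) = 0"
    unfolding set_lebesgue_integral_def
    by (rule integral_eq_zero_AE, use AE_lborel_singleton[of 0] in eventually_elim) auto
  then show ?thesis using True t evolution[of 0 \<xi>] by simp
next
  case False
  with t have "0 < t" "t \<le> T" by auto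
  define E where "E = (\<integral>\<xi>. exp (- \<xi>\<^sup>2 / 2) / (1 + \<xi>\<^sup>2) * (norm (Z t \<xi>))\<^sup>2 \<partial>lborel)"
  have step1: "E \<le> (\<integral>\<xi>. (norm (Z \<kappa> \<xi>))\<^sup>2 / (\<epsilon> + \<xi>\<^sup>2) \<partial>lborel)
      + 2 * (C\<^sup>2 * T) * (\<integral>\<xi>. \<epsilon> / (\<epsilon> + \<xi>\<^sup>2) \<partial>lborel)"
    if \<kappa>: "0 < \<kappa>" "\<kappa> \<le> t" and \<epsilon>: "0 < \<epsilon>" "\<epsilon> \<le> 1" for \<kappa> \<epsilon>
  proof (rule field_le_epsilon)
    fix e :: real assume "0 < e"
    then obtain \<delta> where "0 < \<delta>" "\<delta> \<le> 1" and "- (e / 2) \<le>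
        (LBINT s:{\<kappa>..t}. (\<integral>\<xi>. exp (- (\<delta> * \<xi>)\<^sup>2 / 2) * (W s \<xi> \<bullet> Z s \<xi>) \<partial>lborel))"
      using dissip[of \<kappa> t "e / 2"] \<kappa> \<open>t \<le> T\<close> by auto
    with energy_inequality[of \<kappa> t \<epsilon> \<delta>] \<kappa> \<epsilon> \<open>t \<le> T\<close>
    show "E \<le> (\<integral>\<xi>. (norm (Z \<kappa> \<xi>))\<^sup>2 / (\<epsilon> + \<xi>\<^sup>2) \<partial>lborel)
        + 2 * (C\<^sup>2 * T) * (\<integral>\<xi>. \<epsilon> / (\<epsilon> + \<xi>\<^sup>2) \<partial>lborel) + e"
      by (simp add: E_def)
  qed
  have step2: "E \<le> 2 * (C\<^sup>2 * T) * (\<integral>\<xi>. \<epsilon> / (\<epsilon> + \<xi>\<^sup>2) \<partial>lborel)" if \<epsilon>: "0 < \<epsilon>" "\<epsilon> \<le> 1" for \<epsilon>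
  proof -
    define \<kappa> where "\<kappa> n = t / real (Suc n)" for n
    have \<kappa>: "0 < \<kappa> n" "\<kappa> n \<le> t" for n
      using \<open>0 < t\<close> by (auto simp: \<kappa>_def divide_le_eq)
    have \<kappa>0: "\<kappa> \<longlonglongrightarrow> 0"
      using tendsto_mult_right_zero[OF LIMSEQ_inverse_real_of_nat, of t]
      by (simp add: \<kappa>_def[abs_def] divide_inverse)
    have pos: "0 < \<epsilon> + \<xi>\<^sup>2" for \<xi> :: real using \<epsilon> by (simp add: add_pos_nonneg)
    have "(\<lambda>n. \<integral>\<xi>. (norm (Z (\<kappa> n) \<xi>))\<^sup>2 / (\<epsilon> + \<xi>\<^sup>2) \<partial>lborel) \<longlonglongrightarrow> (\<integral>\<xi>. 0 \<partial>(lborel :: real measure))"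
    proof (rule integral_dominated_convergence[where w = "\<lambda>\<xi>. C\<^sup>2 * (1 / (\<epsilon> + \<xi>\<^sup>2))"])
      have "(\<lambda>n. Z (\<kappa> n) \<xi>) \<longlonglongrightarrow> 0" for \<xi>
      proof (rule tendsto_norm_zero_cancel, rule tendsto_sandwich[of "\<lambda>_. 0"])
        have "norm (Z (\<kappa> n) \<xi>) \<le> \<xi>\<^sup>2 * C * \<kappa> n" for n
        proof -
          have dom: "integrable lborel (\<lambda>s. C * indicat_real {0..\<kappa> n} s)"
            by (intro integrable_mult_right integrable_indicator_Icc)
          have le: "norm (indicat_real {0..\<kappa> n} s *\<^sub>R W s \<xi>) \<le> C * indicat_real {0..\<kappa> n} s" for s
            using W_le by (simp split: split_indicator)
          have "norm (LBINT s:{0..\<kappa> n}. W s \<xi>) \<le> (\<integral>s. C * indicat_real {0..\<kappa> n} s \<partial>lborel)"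
            unfolding set_lebesgue_integral_def
          proof (rule Bochner_Integration.integral_norm_bound_integral[OF _ dom le])
            show "integrable lborel (\<lambda>s. indicat_real {0..\<kappa> n} s *\<^sub>R W s \<xi>)"
              by (rule Bochner_Integration.integrable_bound[OF dom])
                 (use order_trans[OF le abs_ge_self] in auto)
          qed
          also have "\<dots> = C * \<kappa> n" using \<kappa>(1)[of n] by simp
          finally have "\<xi>\<^sup>2 * norm (LBINT s:{0..\<kappa> n}. W s \<xi>) \<le> \<xi>\<^sup>2 * (C * \<kappa> n)"
            by (intro mult_left_mono) auto
          then show ?thesis
            using evolution[of "\<kappa> n" \<xi>] \<kappa>[of n] \<open>t \<le> T\<close> by (simp add: mult.assoc)
        qed
        then show "\<forall>\<^sub>F n in sequentially. norm (Z (\<kappa> n) \<xi>) \<le> \<xi>\<^sup>2 * C * \<kappa> n" by simp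
        show "(\<lambda>n. \<xi>\<^sup>2 * C * \<kappa> n) \<longlonglongrightarrow> 0" using tendsto_mult_right_zero[OF \<kappa>0] .
      qed auto
      then show "AE \<xi> in lborel. (\<lambda>n. (norm (Z (\<kappa> n) \<xi>))\<^sup>2 / (\<epsilon> + \<xi>\<^sup>2)) \<longlonglongrightarrow> 0"
        using pos by (intro AE_I2) (auto intro!: tendsto_eq_intros simp: less_imp_neq[symmetric])
      show "AE \<xi> in lborel. norm ((norm (Z (\<kappa> n) \<xi>))\<^sup>2 / (\<epsilon> + \<xi>\<^sup>2)) \<le> C\<^sup>2 * (1 / (\<epsilon> + \<xi>\<^sup>2))" for n
      proof (intro AE_I2)
        fix \<xi>
        have "(norm (Z (\<kappa> n) \<xi>))\<^sup>2 \<le> C\<^sup>2" using Z_le[of "\<kappa> n" \<xi>] by (intro power_mono) auto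
        then show "norm ((norm (Z (\<kappa> n) \<xi>))\<^sup>2 / (\<epsilon> + \<xi>\<^sup>2)) \<le> C\<^sup>2 * (1 / (\<epsilon> + \<xi>\<^sup>2))"
          using pos[of \<xi>] by (simp add: divide_right_mono abs_of_pos)
      qed
      show "integrable lborel (\<lambda>\<xi>. C\<^sup>2 * (1 / (\<epsilon> + \<xi>\<^sup>2)))"
        by (intro integrable_mult_right integrable_resolvent \<epsilon>)
    qed simp_all
    then have "(\<lambda>n. (\<integral>\<xi>. (norm (Z (\<kappa> n) \<xi>))\<^sup>2 / (\<epsilon> + \<xi>\<^sup>2) \<partial>lborel)
        + 2 * (C\<^sup>2 * T) * (\<integral>\<xi>. \<epsilon> / (\<epsilon> + \<xi>\<^sup>2) \<partial>lborel))
        \<longlonglongrightarrow> 0 + 2 * (C\<^sup>2 * T) * (\<integral>\<xi>. \<epsilon> / (\<epsilon> + \<xi>\<^sup>2) \<partial>lborel)"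
      by (intro tendsto_add tendsto_const) simp
    then have "E \<le> 0 + 2 * (C\<^sup>2 * T) * (\<integral>\<xi>. \<epsilon> / (\<epsilon> + \<xi>\<^sup>2) \<partial>lborel)"
      by (rule LIMSEQ_le_const) (use step1[OF \<kappa> \<epsilon>] in blast)
    then show ?thesis by simp
  qed
  have "(\<lambda>n. 2 * (C\<^sup>2 * T) * (\<integral>\<xi>. (1 / real (Suc n)) / (1 / real (Suc n) + \<xi>\<^sup>2) \<partial>lborel)) \<longlonglongrightarrow> 0"
    by (rule tendsto_mult_right_zero[OF resolvent_mass_tendsto_0])
  then have "E \<le> 0"
    by (rule LIMSEQ_le_const) (rule exI[of _ 0], intro allI impI step2, auto)
  have pos: "0 < exp (- x\<^sup>2 / 2) / (1 + x\<^sup>2)" for x :: real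
    by (intro divide_pos_pos add_pos_nonneg) auto
  have int: "integrable lborel (\<lambda>\<xi>. exp (- \<xi>\<^sup>2 / 2) / (1 + \<xi>\<^sup>2) * (norm (Z t \<xi>))\<^sup>2)"
  proof (rule Bochner_Integration.integrable_bound)
    show "integrable lborel (\<lambda>\<xi>. C\<^sup>2 * (1 / (1 + \<xi>\<^sup>2)))"
      by (intro integrable_mult_right integrable_inverse_one_plus_square)
    show "AE \<xi> in lborel. norm (exp (- \<xi>\<^sup>2 / 2) / (1 + \<xi>\<^sup>2) * (norm (Z t \<xi>))\<^sup>2)
        \<le> norm (C\<^sup>2 * (1 / (1 + \<xi>\<^sup>2)))"
    proof (intro AE_I2)
      fix \<xi>
      have "(norm (Z t \<xi>))\<^sup>2 \<le> C\<^sup>2" using Z_le[of t \<xi>] by (intro power_mono) auto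
      then have "exp (- \<xi>\<^sup>2 / 2) * (norm (Z t \<xi>))\<^sup>2 \<le> 1 * C\<^sup>2" by (intro mult_mono) auto
      then have "exp (- \<xi>\<^sup>2 / 2) * (norm (Z t \<xi>))\<^sup>2 / (1 + \<xi>\<^sup>2) \<le> C\<^sup>2 / (1 + \<xi>\<^sup>2)"
        by (intro divide_right_mono) (auto simp: add_nonneg_nonneg)
      then show "norm (exp (- \<xi>\<^sup>2 / 2) / (1 + \<xi>\<^sup>2) * (norm (Z t \<xi>))\<^sup>2)
          \<le> norm (C\<^sup>2 * (1 / (1 + \<xi>\<^sup>2)))"
        using pos[of \<xi>] by (simp add: abs_mult abs_of_nonneg add_nonneg_nonneg)
    qed
  qed simp
  have nn: "0 \<le> exp (- \<xi>\<^sup>2 / 2) / (1 + \<xi>\<^sup>2) * (norm (Z t \<xi>))\<^sup>2" for \<xi>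
    using pos[of \<xi>] by (intro mult_nonneg_nonneg) (auto simp: less_imp_le)
  have "E = 0" using \<open>E \<le> 0\<close> nn by (intro antisym) (auto simp: E_def intro!: integral_nonneg_AE)
  then have "AE \<xi> in lborel. exp (- \<xi>\<^sup>2 / 2) / (1 + \<xi>\<^sup>2) * (norm (Z t \<xi>))\<^sup>2 = 0"
    using integral_nonneg_eq_0_iff_AE[OF int] nn by (simp add: E_def)
  then have "AE \<xi> in lborel. \<xi> \<in> {\<xi>. Z t \<xi> = 0}"
  proof eventually_elim
    case (elim \<xi>)
    then show ?case using pos[of \<xi>] by (simp only: mult_eq_0_iff) auto
  qed
  moreover have "closed {\<xi>. Z t \<xi> = 0}"
    using cont[of t] by (intro closed_Collect_eq) auto
  ultimately have "\<xi> \<in> {\<xi>. Z t \<xi> = 0}"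
    by (intro mem_closed_if_AE_lebesgue) (simp_all add: AE_completion_iff)
  then show ?thesis by simp
qed

end

section \<open>Square integrable densities of signed measures\<close>

text \<open>
  The defining property of a density is stated for sets; it extends to bounded functions through
  simple functions.
\<close>

lemma signed_density_integral:
  fixes \<phi> :: "real \<Rightarrow> complex"
  assumes \<mu>: "finite_borel_measure \<mu>" and \<nu>: "finite_borel_measure \<nu>"
    and h: "integrable lborel h"
    and dens: "\<And>A. A \<in> sets borel \<Longrightarrow> measure \<mu> A - measure \<nu> A = (\<integral>x. indicator A x * h x \<partial>lborel)"
    and \<phi> [measurable]: "\<phi> \<in> borel_measurable borel" and bnd: "\<And>x. norm (\<phi> x) \<le> M"
  shows "(\<integral>x. \<phi> x \<partial>\<mu>) - (\<integral>x. \<phi> x \<partial>\<nu>) = (\<integral>x. h x *\<^sub>R \<phi> x \<partial>lborel)"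
proof -
  interpret \<mu>: finite_borel_measure \<mu> by fact
  interpret \<nu>: finite_borel_measure \<nu> by fact
  note [measurable_cong] = \<mu>.M_is_borel \<nu>.M_is_borel
  have [measurable]: "h \<in> borel_measurable borel" using borel_measurable_integrable[OF h] by simp
  obtain F where F: "\<And>i. simple_function borel (F i)"
    and lim: "\<And>x. (\<lambda>i. F i x) \<longlonglongrightarrow> \<phi> x" and F_le: "\<And>i x. dist (F i x) 0 \<le> 2 * dist (\<phi> x) 0"
    using borel_measurable_implies_sequence_metric[OF \<phi>, of 0] by auto
  have [measurable]: "F i \<in> borel_measurable borel" for i
    by (rule borel_measurable_simple_function) (rule F)
  have F_bnd: "norm (F i x) \<le> 2 * M" for i x
    using F_le[of i x] bnd[of x] by simp
  have M: "0 \<le> M" using bnd[of 0] norm_ge_zero order_trans by blast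
  have simple: "(\<integral>x. F i x \<partial>\<mu>) - (\<integral>x. F i x \<partial>\<nu>) = (\<integral>x. h x *\<^sub>R F i x \<partial>lborel)" for i
  proof -
    let ?R = "range (F i)" and ?A = "\<lambda>y. F i -` {y}"
    have fin: "finite ?R" using F[of i] by (simp add: simple_function_def)
    have A [measurable]: "?A y \<in> sets borel" for y
      using measurable_sets[of "F i" borel borel "{y}"] by simp
    have rep: "F i x = (\<Sum>y\<in>?R. indicator (?A y) x *\<^sub>R y)" for x
    proof -
      have "(\<Sum>y\<in>?R. indicator (?A y) x *\<^sub>R y) = (\<Sum>y\<in>?R. if y = F i x then y else 0)"
        by (intro sum.cong) (auto simp: indicator_def)
      then show ?thesis using fin by simp
    qed
    have mu: "(\<integral>x. F i x \<partial>\<mu>) = (\<Sum>y\<in>?R. measure \<mu> (?A y) *\<^sub>R y)"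
    proof -
      have "(\<integral>x. F i x \<partial>\<mu>) = (\<integral>x. (\<Sum>y\<in>?R. indicator (?A y) x *\<^sub>R y) \<partial>\<mu>)"
        by (simp only: rep[symmetric])
      also have "\<dots> = (\<Sum>y\<in>?R. (\<integral>x. indicator (?A y) x *\<^sub>R y \<partial>\<mu>))"
        by (intro Bochner_Integration.integral_sum integrable_scaleR_left \<mu>.integrable_bounded[where C = 1]) auto
      also have "\<dots> = (\<Sum>y\<in>?R. measure \<mu> (?A y) *\<^sub>R y)"
        by (intro sum.cong refl, subst integral_scaleR_left)
           (auto intro!: \<mu>.integrable_bounded[where C = 1] simp: \<mu>.borel_UNIV)
      finally show ?thesis .
    qed
    have nu: "(\<integral>x. F i x \<partial>\<nu>) = (\<Sum>y\<in>?R. measure \<nu> (?A y) *\<^sub>R y)"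
    proof -
      have "(\<integral>x. F i x \<partial>\<nu>) = (\<integral>x. (\<Sum>y\<in>?R. indicator (?A y) x *\<^sub>R y) \<partial>\<nu>)"
        by (simp only: rep[symmetric])
      also have "\<dots> = (\<Sum>y\<in>?R. (\<integral>x. indicator (?A y) x *\<^sub>R y \<partial>\<nu>))"
        by (intro Bochner_Integration.integral_sum integrable_scaleR_left \<nu>.integrable_bounded[where C = 1]) auto
      also have "\<dots> = (\<Sum>y\<in>?R. measure \<nu> (?A y) *\<^sub>R y)"
        by (intro sum.cong refl, subst integral_scaleR_left)
           (auto intro!: \<nu>.integrable_bounded[where C = 1] simp: \<nu>.borel_UNIV)
      finally show ?thesis .
    qed
    have Ah: "integrable lborel (\<lambda>x. indicator (?A y) x * h x)" for y
      using integrable_mult_indicator[OF _ h, of "?A y"] A[of y] by simp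
    have "(\<integral>x. h x *\<^sub>R F i x \<partial>lborel) = (\<integral>x. (\<Sum>y\<in>?R. (indicator (?A y) x * h x) *\<^sub>R y) \<partial>lborel)"
      by (intro Bochner_Integration.integral_cong refl, subst rep)
         (simp add: scaleR_sum_right mult.commute)
    also have "\<dots> = (\<Sum>y\<in>?R. (\<integral>x. indicator (?A y) x * h x \<partial>lborel) *\<^sub>R y)"
      using Ah by (simp add: Bochner_Integration.integral_sum)
    also have "\<dots> = (\<Sum>y\<in>?R. measure \<mu> (?A y) *\<^sub>R y) - (\<Sum>y\<in>?R. measure \<nu> (?A y) *\<^sub>R y)"
      by (simp add: sum_subtractf scaleR_diff_left flip: dens[OF A])
    finally show ?thesis by (simp only: mu nu)
  qed
  have "(\<lambda>i. \<integral>x. F i x \<partial>\<mu>) \<longlonglongrightarrow> (\<integral>x. \<phi> x \<partial>\<mu>)"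
    by (rule integral_dominated_convergence[where w = "\<lambda>_. 2 * M"]) (use F_bnd lim in auto)
  moreover have "(\<lambda>i. \<integral>x. F i x \<partial>\<nu>) \<longlonglongrightarrow> (\<integral>x. \<phi> x \<partial>\<nu>)"
    by (rule integral_dominated_convergence[where w = "\<lambda>_. 2 * M"]) (use F_bnd lim in auto)
  ultimately have "(\<lambda>i. \<integral>x. h x *\<^sub>R F i x \<partial>lborel) \<longlonglongrightarrow> (\<integral>x. \<phi> x \<partial>\<mu>) - (\<integral>x. \<phi> x \<partial>\<nu>)"
    unfolding simple[symmetric] by (rule tendsto_diff)
  moreover have "(\<lambda>i. \<integral>x. h x *\<^sub>R F i x \<partial>lborel) \<longlonglongrightarrow> (\<integral>x. h x *\<^sub>R \<phi> x \<partial>lborel)"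
  proof (rule integral_dominated_convergence[where w = "\<lambda>x. 2 * M * norm (h x)"])
    show "integrable lborel (\<lambda>x. 2 * M * norm (h x))" using h by simp
    show "AE x in lborel. (\<lambda>i. h x *\<^sub>R F i x) \<longlonglongrightarrow> h x *\<^sub>R \<phi> x"
      by (intro AE_I2 tendsto_scaleR lim tendsto_const)
    show "AE x in lborel. norm (h x *\<^sub>R F i x) \<le> 2 * M * norm (h x)" for i
      using F_bnd by (intro AE_I2) (auto simp: mult.commute intro!: mult_left_mono)
  qed simp_all
  ultimately show ?thesis by (rule LIMSEQ_unique)
qed

text \<open>
  The given density is only Lebesgue measurable, so Tonelli's theorem is applied to a Borel version of its
  square on the plane, and a Borel version \<open>h\<close> of the density is chosen separately for almost every time.
\<close>

lemma square_integrable_density_slices: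
  fixes \<rho> :: "real \<times> real \<Rightarrow> real"
  assumes sq: "square_integrable_on \<rho> ({\<kappa>..T} \<times> UNIV)" and "0 < \<kappa>"
    and dens: "AE t in lborel. t \<in> {0<..T} \<longrightarrow> is_signed_density (\<lambda>x. \<rho> (t, x)) (\<zeta> t)"
  obtains D where "integrable lborel D"
    "AE s in lborel. s \<in> {\<kappa>..T} \<longrightarrow> (\<exists>h. integrable lborel h \<and>
       integrable lborel (\<lambda>x. (h x)\<^sup>2) \<and> (\<integral>x. (h x)\<^sup>2 \<partial>lborel) = D s \<and>
       (\<forall>A\<in>sets borel. \<zeta> s A = (\<integral>x. indicator A x * h x \<partial>lborel)))"
proof -
  let ?S = "{\<kappa>..T} \<times> (UNIV :: real set)"
  have S: "?S \<in> sets lebesgue"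
    by (intro sets_completionI_sets) (simp add: borel_closed closed_Times)
  have "integrable lebesgue (\<lambda>p. indicator ?S p *\<^sub>R (\<rho> p)\<^sup>2)"
    using sq S unfolding square_integrable_on_def
    by (subst (asm) integrable_restrict_space) (auto simp: mult.commute)
  then have int: "integrable lebesgue (\<lambda>p. indicator ?S p * (\<rho> p)\<^sup>2)" by simp
  obtain g where g [measurable]: "g \<in> borel_measurable (lborel :: (real \<times> real) measure)"
    and g_eq: "AE p in lborel. indicator ?S p * (\<rho> p)\<^sup>2 = g p"
    using completion_ex_borel_measurable_real[OF borel_measurable_integrable[OF int]] by blast
  have "integrable lebesgue g"
    using int g_eq by (subst integrable_cong_AE[symmetric, OF borel_measurable_integrable[OF int]])
      (auto simp: AE_completion_iff measurable_completion)
  then have "integrable lborel g" by (simp add: integrable_completion)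
  then have g_int: "integrable (lborel \<Otimes>\<^sub>M lborel) g" by (simp add: lborel_prod)
  have "AE p in lborel \<Otimes>\<^sub>M lborel. indicator ?S p * (\<rho> p)\<^sup>2 = g p"
    unfolding lborel_prod by (rule g_eq)
  from lborel_pair.AE_pair[OF this]
  have slice_eq: "AE s in lborel. AE x in lborel. indicator ?S (s, x) * (\<rho> (s, x))\<^sup>2 = g (s, x)" .
  have slice_int: "AE s in lborel. integrable lborel (\<lambda>x. g (s, x))"
    by (rule lborel_pair.AE_integrable_fst'[OF g_int])
  define D where "D s = (\<integral>x. g (s, x) \<partial>lborel)" for s
  have "integrable lborel D"
    unfolding D_def[abs_def] by (rule lborel_pair.integrable_fst'[OF g_int])
  moreover have "AE s in lborel. s \<in> {\<kappa>..T} \<longrightarrow> (\<exists>h. integrable lborel h \<and>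
       integrable lborel (\<lambda>x. (h x)\<^sup>2) \<and> (\<integral>x. (h x)\<^sup>2 \<partial>lborel) = D s \<and>
       (\<forall>A\<in>sets borel. \<zeta> s A = (\<integral>x. indicator A x * h x \<partial>lborel)))"
    using slice_eq slice_int dens
  proof eventually_elim
    case (elim s)
    show ?case
    proof
      assume s: "s \<in> {\<kappa>..T}"
      with elim(3) \<open>0 < \<kappa>\<close> have "is_signed_density (\<lambda>x. \<rho> (s, x)) (\<zeta> s)" by auto
      then have r: "integrable lebesgue (\<lambda>x. \<rho> (s, x))"
        and \<zeta>: "\<And>A. A \<in> sets borel \<Longrightarrow> \<zeta> s A = (LINT x:A|lebesgue. \<rho> (s, x))"
        by (auto simp: is_signed_density_def)
      obtain h where h [measurable]: "h \<in> borel_measurable lborel"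
        and h_eq: "AE x in lborel. \<rho> (s, x) = h x"
        using completion_ex_borel_measurable_real[OF borel_measurable_integrable[OF r]] by blast
      have "integrable lebesgue h"
        using r h_eq by (subst integrable_cong_AE[symmetric, OF borel_measurable_integrable[OF r]])
          (auto simp: AE_completion_iff measurable_completion)
      then have hi: "integrable lborel h" by (simp add: integrable_completion)
      have gs: "(\<lambda>x. g (s, x)) \<in> borel_measurable lborel"
        using borel_measurable_integrable[OF elim(2)] .
      have sq_eq: "AE x in lborel. g (s, x) = (h x)\<^sup>2"
        using elim(1) h_eq by eventually_elim (use s in auto)
      have h2: "integrable lborel (\<lambda>x. (h x)\<^sup>2)"
        using elim(2) integrable_cong_AE[OF gs _ sq_eq] by simp
      moreover have "(\<integral>x. (h x)\<^sup>2 \<partial>lborel) = D s"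
        unfolding D_def by (rule integral_cong_AE[symmetric, OF gs _ sq_eq]) simp
      moreover have "\<zeta> s A = (\<integral>x. indicator A x * h x \<partial>lborel)" if A: "A \<in> sets borel" for A
      proof -
        have "\<zeta> s A = (\<integral>x. indicator A x *\<^sub>R \<rho> (s, x) \<partial>lebesgue)"
          using \<zeta>[OF A] by (simp add: set_lebesgue_integral_def)
        also have "\<dots> = (\<integral>x. indicator A x * h x \<partial>lebesgue)"
        proof (rule integral_cong_AE)
          show "AE x in lebesgue. indicator A x *\<^sub>R \<rho> (s, x) = indicator A x * h x"
            unfolding AE_completion_iff using h_eq by eventually_elim simp
          show "(\<lambda>x. indicator A x * h x) \<in> borel_measurable lebesgue"
            using A by (intro measurable_completion) simp
          show "(\<lambda>x. indicator A x *\<^sub>R \<rho> (s, x)) \<in> borel_measurable lebesgue"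
            using A borel_measurable_integrable[OF r] by (intro borel_measurable_scaleR borel_measurable_indicator) auto
        qed
        also have "\<dots> = (\<integral>x. indicator A x * h x \<partial>lborel)"
          using A by (intro integral_completion) simp
        finally show ?thesis .
      qed
      ultimately show "\<exists>h. integrable lborel h \<and>
         integrable lborel (\<lambda>x. (h x)\<^sup>2) \<and> (\<integral>x. (h x)\<^sup>2 \<partial>lborel) = D s \<and>
         (\<forall>A\<in>sets borel. \<zeta> s A = (\<integral>x. indicator A x * h x \<partial>lborel))"
        using hi by blast
    qed
  qed
  ultimately show thesis by (rule that)
qed

section \<open>Asymptotic sign of the dissipation\<close>

text \<open>
  For almost every time the integral over \<open>\<xi>\<close> tends to \<open>2 pi \<integral> b h\<^sup>2 \<ge> 0\<close> as \<open>\<delta> \<rightarrow> 0\<close>, and it is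
  dominated by a multiple of \<open>D\<close>. Only the negative parts are passed to the limit in time, because
  their limit 0 is evidently measurable.
\<close>

lemma dissipation_almost_nonnegative:
  fixes W Z :: "real \<Rightarrow> real \<Rightarrow> complex" and b :: "real \<times> real \<Rightarrow> real"
  assumes [measurable]: "case_prod W \<in> borel_measurable (borel \<Otimes>\<^sub>M borel)"
      "case_prod Z \<in> borel_measurable (borel \<Otimes>\<^sub>M borel)"
      "b \<in> borel_measurable (borel \<Otimes>\<^sub>M borel)"
    and b: "\<And>p. 0 \<le> b p" "\<And>p. b p \<le> K"
    and D: "integrable lborel D"
    and slices: "AE s in lborel. s \<in> {\<kappa>..t} \<longrightarrow> (\<exists>h. integrable lborel h \<and>
       integrable lborel (\<lambda>x. (h x)\<^sup>2) \<and> (\<integral>x. (h x)\<^sup>2 \<partial>lborel) = D s \<and>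
       (\<forall>\<xi>. Z s \<xi> = (\<integral>x. h x *\<^sub>R iexp (\<xi> * x) \<partial>lborel)) \<and>
       (\<forall>\<xi>. W s \<xi> = (\<integral>x. (b (s, x) * h x) *\<^sub>R iexp (\<xi> * x) \<partial>lborel)))"
    and "0 < e"
  shows "\<exists>\<delta>>0. \<delta> \<le> 1 \<and>
    - e \<le> (LBINT s:{\<kappa>..t}. (\<integral>\<xi>. exp (- (\<delta> * \<xi>)\<^sup>2 / 2) * (W s \<xi> \<bullet> Z s \<xi>) \<partial>lborel))"
proof -
  define \<delta> where "\<delta> n = 1 / real (Suc n)" for n
  have \<delta>: "0 < \<delta> n" "\<delta> n \<le> 1" for n by (auto simp: \<delta>_def)
  have \<delta>0: "\<delta> \<longlonglongrightarrow> 0"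
    unfolding \<delta>_def using LIMSEQ_inverse_real_of_nat by (simp add: inverse_eq_divide)
  define Q where "Q n s = (\<integral>\<xi>. exp (- (\<delta> n * \<xi>)\<^sup>2 / 2) * (W s \<xi> \<bullet> Z s \<xi>) \<partial>lborel)" for n s
  have [measurable]: "Q n \<in> borel_measurable borel" for n
    unfolding Q_def[abs_def] by measurable
  define B where "B s = pi * ((K\<^sup>2 + 1) * D s)" for s
  have B: "integrable lborel B" unfolding B_def using D by simp
  have K: "0 \<le> K" using b[of undefined] by simp
  have slice: "AE s in lborel. s \<in> {\<kappa>..t} \<longrightarrow> (\<forall>n. \<bar>Q n s\<bar> \<le> B s) \<and> (\<lambda>n. max 0 (- Q n s)) \<longlonglongrightarrow> 0"
    using slices
  proof eventually_elim
    case (elim s)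
    show ?case
    proof
      assume "s \<in> {\<kappa>..t}"
      with elim obtain h where h: "integrable lborel h" and h2: "integrable lborel (\<lambda>x. (h x)\<^sup>2)"
        and hD: "(\<integral>x. (h x)\<^sup>2 \<partial>lborel) = D s"
        and Z: "\<And>\<xi>. Z s \<xi> = (\<integral>x. h x *\<^sub>R iexp (\<xi> * x) \<partial>lborel)"
        and W: "\<And>\<xi>. W s \<xi> = (\<integral>x. (b (s, x) * h x) *\<^sub>R iexp (\<xi> * x) \<partial>lborel)"
        by blast
      have [measurable]: "h \<in> borel_measurable borel" using borel_measurable_integrable[OF h] by simp
      define f where "f x = b (s, x) * h x" for x
      have [measurable]: "f \<in> borel_measurable borel" unfolding f_def[abs_def] by measurable
      have f_le: "\<bar>f x\<bar> \<le> K * \<bar>h x\<bar>" for x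
        using b by (simp add: f_def abs_mult mult_right_mono)
      have f: "integrable lborel f"
      proof (rule Bochner_Integration.integrable_bound)
        show "integrable lborel (\<lambda>x. K * \<bar>h x\<bar>)" using h by simp
        show "AE x in lborel. norm (f x) \<le> norm (K * \<bar>h x\<bar>)"
          using f_le K by (simp add: abs_mult)
      qed simp
      have f2_le: "(f x)\<^sup>2 \<le> K\<^sup>2 * (h x)\<^sup>2" for x
        using power_mono[OF f_le[of x] abs_ge_zero, of 2] by (simp add: power_mult_distrib)
      have f2: "integrable lborel (\<lambda>x. (f x)\<^sup>2)"
      proof (rule Bochner_Integration.integrable_bound)
        show "integrable lborel (\<lambda>x. K\<^sup>2 * (h x)\<^sup>2)" using h2 by simp
        show "AE x in lborel. norm ((f x)\<^sup>2) \<le> norm (K\<^sup>2 * (h x)\<^sup>2)"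
          using f2_le by simp
      qed simp
      have Q: "Q n s = 2 * pi * gauss_corr f h (\<delta> n)" for n
        unfolding Q_def W Z f_def[symmetric] by (rule gaussian_parseval[OF f h f2 h2 \<delta>(1)])
      have f2_int: "(\<integral>x. (f x)\<^sup>2 \<partial>lborel) \<le> K\<^sup>2 * D s"
      proof -
        have "(\<integral>x. (f x)\<^sup>2 \<partial>lborel) \<le> (\<integral>x. K\<^sup>2 * (h x)\<^sup>2 \<partial>lborel)"
          using f2 h2 f2_le by (intro integral_mono) auto
        then show ?thesis by (simp add: hD)
      qed
      have "\<bar>Q n s\<bar> \<le> B s" for n
      proof -
        have "\<bar>gauss_corr f h (\<delta> n)\<bar> \<le> (1 * (\<integral>x. (f x)\<^sup>2 \<partial>lborel) + (\<integral>x. (h x)\<^sup>2 \<partial>lborel) / 1) / 2"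
          by (rule gauss_corr_bound(2)) (use f2 h2 in auto)
        also have "\<dots> \<le> (K\<^sup>2 + 1) * D s / 2"
          using f2_int by (simp add: hD algebra_simps)
        finally have "2 * pi * \<bar>gauss_corr f h (\<delta> n)\<bar> \<le> 2 * pi * ((K\<^sup>2 + 1) * D s / 2)"
          by (intro mult_left_mono) auto
        then show ?thesis by (simp add: Q B_def abs_mult)
      qed
      moreover have "(\<lambda>n. max 0 (- Q n s)) \<longlonglongrightarrow> 0"
      proof -
        have "(\<lambda>n. Q n s) \<longlonglongrightarrow> 2 * pi * (\<integral>x. f x * h x \<partial>lborel)"
          unfolding Q by (intro tendsto_mult_left gauss_corr_tendsto h f2 h2 \<delta>0) simp
        then have "(\<lambda>n. max 0 (- Q n s)) \<longlonglongrightarrow> max 0 (- (2 * pi * (\<integral>x. f x * h x \<partial>lborel)))"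
          by (intro tendsto_max tendsto_const tendsto_minus)
        moreover have "0 \<le> (\<integral>x. f x * h x \<partial>lborel)"
          using b(1) by (intro integral_nonneg_AE AE_I2) (simp add: f_def mult.assoc)
        ultimately show ?thesis by (simp add: max_absorb1)
      qed
      ultimately show "(\<forall>n. \<bar>Q n s\<bar> \<le> B s) \<and> (\<lambda>n. max 0 (- Q n s)) \<longlonglongrightarrow> 0" by blast
    qed
  qed
  have N_lim: "(\<lambda>n. \<integral>s. indicator {\<kappa>..t} s * max 0 (- Q n s) \<partial>lborel) \<longlonglongrightarrow> (\<integral>s. 0 \<partial>(lborel :: real measure))"
  proof (rule integral_dominated_convergence[where w = "\<lambda>s. norm (B s)"])
    show "integrable lborel (\<lambda>s. norm (B s))" using B by simp
    show "AE s in lborel. (\<lambda>n. indicator {\<kappa>..t} s * max 0 (- Q n s)) \<longlonglongrightarrow> 0"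
      using slice
    proof eventually_elim
      case (elim s)
      then show ?case by (cases "s \<in> {\<kappa>..t}") auto
    qed
    show "AE s in lborel. norm (indicator {\<kappa>..t} s * max 0 (- Q n s)) \<le> norm (B s)" for n
      using slice
    proof eventually_elim
      case (elim s)
      show ?case
      proof (cases "s \<in> {\<kappa>..t}")
        case True
        with elim have "\<bar>Q n s\<bar> \<le> B s" by blast
        then have "\<bar>max 0 (- Q n s)\<bar> \<le> \<bar>B s\<bar>" by linarith
        with True show ?thesis by simp
      qed simp
    qed
  qed simp_all
  then have "\<forall>\<^sub>F n in sequentially. (\<integral>s. indicator {\<kappa>..t} s * max 0 (- Q n s) \<partial>lborel) < e"
    using \<open>0 < e\<close> by (intro order_tendstoD) auto
  then obtain n where n: "(\<integral>s. indicator {\<kappa>..t} s * max 0 (- Q n s) \<partial>lborel) < e"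
    by (auto simp: eventually_sequentially)
  have int: "integrable lborel (\<lambda>s. indicator {\<kappa>..t} s * F (Q n s))"
    if [measurable]: "F \<in> borel_measurable borel" and "\<And>x. \<bar>F x\<bar> \<le> \<bar>x\<bar>" for F :: "real \<Rightarrow> real"
  proof (rule Bochner_Integration.integrable_bound[OF B])
    show "AE s in lborel. norm (indicator {\<kappa>..t} s * F (Q n s)) \<le> norm (B s)"
      using slice
    proof eventually_elim
      case (elim s)
      show ?case
      proof (cases "s \<in> {\<kappa>..t}")
        case True
        with elim have "\<bar>Q n s\<bar> \<le> B s" by blast
        with that(2)[of "Q n s"] True show ?thesis by simp
      qed simp
    qed
  qed simp
  have "- (\<integral>s. indicator {\<kappa>..t} s * max 0 (- Q n s) \<partial>lborel)
      = (\<integral>s. indicator {\<kappa>..t} s * - max 0 (- Q n s) \<partial>lborel)" by simp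
  also have "\<dots> \<le> (\<integral>s. indicator {\<kappa>..t} s * Q n s \<partial>lborel)"
    using int[of "\<lambda>x. - max 0 (- x)"] int[of "\<lambda>x. x"]
    by (intro integral_mono) (auto simp: indicator_def)
  finally have "- e \<le> (LBINT s:{\<kappa>..t}. Q n s)"
    using n by (simp add: set_lebesgue_integral_def)
  then show ?thesis unfolding Q_def using \<delta>[of n] by blast
qed


section \<open>Uniqueness for the diffusion equation\<close>

text \<open>
  Levy's uniqueness theorem concerns probability measures. The total mass is the value of the transform
  at 0, so both measures can be divided by the same constant.
\<close>

lemma finite_measure_char_uniqueness:
  assumes \<mu>: "finite_borel_measure \<mu>" and \<nu>: "finite_borel_measure \<nu>"
    and eq: "char \<mu> = char \<nu>"
  shows "\<mu> = \<nu>"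
proof -
  have mass: "char \<kappa> 0 = complex_of_real (measure \<kappa> UNIV)" if "finite_borel_measure \<kappa>" for \<kappa>
  proof -
    interpret finite_borel_measure \<kappa> by fact
    show ?thesis by (simp add: char_def borel_UNIV scaleR_conv_of_real)
  qed
  define c where "c = measure \<mu> UNIV"
  have c: "measure \<nu> UNIV = c"
    using mass[OF \<mu>] mass[OF \<nu>] eq by (simp add: c_def)
  interpret \<mu>: finite_borel_measure \<mu> by fact
  interpret \<nu>: finite_borel_measure \<nu> by fact
  show ?thesis
  proof (cases "c = 0")
    case True
    show ?thesis
    proof (rule measure_eqI)
      show "sets \<mu> = sets \<nu>" by (simp add: \<mu>.M_is_borel \<nu>.M_is_borel)
      fix A
      have "measure \<mu> A = 0" "measure \<nu> A = 0"
        using \<mu>.bounded_measure[of A] \<nu>.bounded_measure[of A] True c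
        by (simp_all add: c_def \<mu>.borel_UNIV \<nu>.borel_UNIV measure_le_0_iff)
      then show "emeasure \<mu> A = emeasure \<nu> A"
        by (simp add: \<mu>.emeasure_eq_measure \<nu>.emeasure_eq_measure)
    qed
  next
    case False
    then have "0 < c" using measure_nonneg[of \<mu> UNIV] unfolding c_def by linarith
    define N where "N \<kappa> = density \<kappa> (\<lambda>_. ennreal (1 / c))" for \<kappa> :: "real measure"
    have N: "emeasure (N \<kappa>) A = ennreal (measure \<kappa> A / c)"
      if "finite_borel_measure \<kappa>" "A \<in> sets borel" for \<kappa> A
    proof -
      interpret finite_borel_measure \<kappa> by fact
      show ?thesis
        using that(2) \<open>0 < c\<close>
        by (simp add: N_def emeasure_density nn_integral_cmult_indicator M_is_borel emeasure_eq_measure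
            flip: ennreal_mult)
    qed
    have dist: "real_distribution (N \<kappa>)" if "finite_borel_measure \<kappa>" "measure \<kappa> UNIV = c" for \<kappa>
    proof (rule real_distribution.intro)
      interpret finite_borel_measure \<kappa> by fact
      show "prob_space (N \<kappa>)"
        using N[OF that(1), of UNIV] that(2) \<open>0 < c\<close>
        by (intro prob_spaceI) (simp add: N_def borel_UNIV)
      show "real_distribution_axioms (N \<kappa>)"
        by standard (simp add: N_def M_is_borel)
    qed
    have char_N: "char (N \<kappa>) t = char \<kappa> t / c" if "finite_borel_measure \<kappa>" for \<kappa> t
    proof -
      interpret finite_borel_measure \<kappa> by fact
      note [measurable_cong] = M_is_borel
      show ?thesis
        unfolding char_def N_def using \<open>0 < c\<close>
        by (subst integral_density) (auto simp: scaleR_conv_of_real)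
    qed
    have "N \<mu> = N \<nu>"
      using dist[OF \<mu>] dist[OF \<nu>] c char_N[OF \<mu>] char_N[OF \<nu>] eq
      by (intro Levy_uniqueness) (auto simp: c_def)
    show ?thesis
    proof (rule measure_eqI)
      show "sets \<mu> = sets \<nu>" by (simp add: \<mu>.M_is_borel \<nu>.M_is_borel)
      fix A assume "A \<in> sets \<mu>"
      then have "ennreal (measure \<mu> A / c) = ennreal (measure \<nu> A / c)"
        using N[OF \<mu>, of A] N[OF \<nu>, of A] \<open>N \<mu> = N \<nu>\<close> by (simp add: \<mu>.M_is_borel)
      then have "measure \<mu> A = measure \<nu> A" using \<open>0 < c\<close> by simp
      then show "emeasure \<mu> A = emeasure \<nu> A"
        by (simp add: \<mu>.emeasure_eq_measure \<nu>.emeasure_eq_measure)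
    qed
  qed
qed

lemma kernel_transform:
  assumes "bounded_kernel z B"
    and [measurable]: "b \<in> borel_measurable (borel \<Otimes>\<^sub>M borel)" and b: "\<And>p. \<bar>b p\<bar> \<le> K"
  shows "(\<lambda>(s, \<xi>). \<integral>x. b (s, x) *\<^sub>R iexp (\<xi> * x) \<partial>z s) \<in> borel_measurable (borel \<Otimes>\<^sub>M borel)"
    and "norm (\<integral>x. b (s, x) *\<^sub>R iexp (\<xi> * x) \<partial>z s) \<le> K * B"
proof -
  interpret bounded_kernel z B by fact
  have "(\<lambda>p. \<integral>x. b (fst p, x) *\<^sub>R iexp (snd p * x) \<partial>z (fst p)) \<in> borel_measurable (borel \<Otimes>\<^sub>M borel)"
    by (rule integral_measurable[where C = K]) (use b in auto)
  then show "(\<lambda>(s, \<xi>). \<integral>x. b (s, x) *\<^sub>R iexp (\<xi> * x) \<partial>z s) \<in> borel_measurable (borel \<Otimes>\<^sub>M borel)"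
    by (simp add: case_prod_unfold)
  show "norm (\<integral>x. b (s, x) *\<^sub>R iexp (\<xi> * x) \<partial>z s) \<le> K * B"
    by (rule norm_integral_le) (use b in auto)
qed

lemma continuous_char:
  assumes "finite_borel_measure \<mu>"
  shows "continuous_on UNIV (char \<mu>)"
proof (rule continuous_at_imp_continuous_on, intro ballI)
  interpret finite_borel_measure \<mu> by fact
  note [measurable_cong] = M_is_borel
  fix t :: real
  show "isCont (char \<mu>) t"
    unfolding continuous_at_sequentially
  proof safe
    fix X assume X: "X \<longlonglongrightarrow> t"
    show "(char \<mu> \<circ> X) \<longlonglongrightarrow> char \<mu> t"
      unfolding comp_def char_def
      by (rule integral_dominated_convergence[where w = "\<lambda>_. 1"]) (auto intro!: tendsto_intros X)
  qed
qed

text \<open>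
  Freezing the curve outside \<open>[0,T]\<close> keeps it continuous; its mass is bounded by compactness.
\<close>

lemma clamped_bounded_kernel:
  fixes z :: "real \<Rightarrow> real measure"
  assumes "0 < T" and cont: "continuous_map (top_of_set {0..T}) weak_measure_topology z"
  obtains B where "bounded_kernel (\<lambda>s. z (max 0 (min T s))) B"
proof -
  have fin: "finite_borel_measure (z t)" if "t \<in> {0..T}" for t
    using cont that by (auto simp: continuous_map_weak_measure_topology_iff)
  have c: "continuous_on {0..T} (\<lambda>t. \<integral>x. f x \<partial>z t)"
    if "continuous_on UNIV f" "bounded (range f)" for f :: "real \<Rightarrow> real"
    using cont that by (auto simp: continuous_map_weak_measure_topology_iff)
  have "compact ((\<lambda>t. \<integral>x. (1::real) \<partial>z t) ` {0..T})"
    by (intro compact_continuous_image c[of "\<lambda>_. 1"]) auto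
  then have "bounded ((\<lambda>t. \<integral>x. (1::real) \<partial>z t) ` {0..T})"
    by (rule compact_imp_bounded)
  then obtain B where "\<forall>m \<in> (\<lambda>t. \<integral>x. (1::real) \<partial>z t) ` {0..T}. norm m \<le> B"
    unfolding bounded_iff by blast
  then have B: "norm (\<integral>x. (1::real) \<partial>z t) \<le> B" if "t \<in> {0..T}" for t
    using that by (rule bspec[OF _ imageI])
  have mem: "max 0 (min T s) \<in> {0..T}" for s using \<open>0 < T\<close> by auto
  have "bounded_kernel (\<lambda>s. z (max 0 (min T s))) B"
  proof (rule weakly_continuous_imp_bounded_kernel)
    show "finite_borel_measure (z (max 0 (min T s)))" for s by (rule fin[OF mem])
    show "continuous_on UNIV (\<lambda>s. \<integral>x. f x \<partial>z (max 0 (min T s)))"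
      if "continuous_on UNIV f" "bounded (range f)" for f :: "real \<Rightarrow> real"
      using mem by (intro continuous_on_compose2[OF c[OF that]] continuous_intros) auto
    show "measure (z (max 0 (min T s))) UNIV \<le> B" for s
      using B[OF mem[of s]] finite_borel_measure.borel_UNIV[OF fin[OF mem[of s]]] by simp
  qed
  then show thesis by (rule that)
qed

theorem theorem3p8:
  fixes T :: real
    and a :: "real \<times> real \<Rightarrow> real"
    and z1 z2 :: "real \<Rightarrow> real measure"
    and z0 :: "real measure"
    and \<rho> :: "real \<times> real \<Rightarrow> real"
  assumes "T > 0"
    and "a \<in> borel_measurable (restrict_space borel ({0..T} \<times> UNIV))"
    and "\<And>p. p \<in> {0..T} \<times> UNIV \<Longrightarrow> a p \<ge> 0"
    and "bounded (a ` ({0..T} \<times> UNIV))"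
    and "continuous_map (top_of_set {0..T}) weak_measure_topology z1"
    and "continuous_map (top_of_set {0..T}) weak_measure_topology z2"
    and "finite_borel_measure z0"
    and "solves_diffusion T a z0 z1"
    and "solves_diffusion T a z0 z2"
    and "\<And>\<kappa>. \<kappa> > 0 \<Longrightarrow> square_integrable_on \<rho> ({\<kappa>..T} \<times> UNIV)"
    and "AE t in lborel. t \<in> {0<..T} \<longrightarrow>
           is_signed_density (\<lambda>x. \<rho> (t, x)) (signed_diff (z1 t) (z2 t))"
  shows "\<forall>t\<in>{0..T}. \<forall>A\<in>sets borel. signed_diff (z1 t) (z2 t) A = 0"
proof -
  \<comment> \<open>Extending the coefficient by 0 and freezing the curves outside \<open>[0,T]\<close> makes all data Borel
    measurable in time on the whole line.\<close>
  define b where "b p = a p * indicator ({0..T} \<times> UNIV) p" for p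
  have "closed ({0..T} \<times> (UNIV :: real set))" by (intro closed_Times) auto
  then have "b \<in> borel_measurable borel"
    using assms(2) unfolding b_def[abs_def]
    by (subst (asm) borel_measurable_restrict_space_iff) (auto simp: mult.commute borel_closed)
  then have b [measurable]: "b \<in> borel_measurable (borel \<Otimes>\<^sub>M borel)" by (simp add: borel_prod)
  obtain K where K: "\<And>p. p \<in> {0..T} \<times> UNIV \<Longrightarrow> norm (a p) \<le> K"
    using assms(4) unfolding bounded_iff by (metis imageI)
  have K0: "0 \<le> K" using K[of "(0, 0)"] assms(1) norm_ge_zero order_trans by fastforce
  have b0: "0 \<le> b p" and bK: "b p \<le> K" and b_abs: "\<bar>b p\<bar> \<le> K" for p
    using assms(3)[of p] K[of p] K0 by (auto simp: b_def indicator_def)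
  define y1 where "y1 s = z1 (max 0 (min T s))" for s
  define y2 where "y2 s = z2 (max 0 (min T s))" for s
  have y: "y1 t = z1 t" "y2 t = z2 t" if "t \<in> {0..T}" for t
    using that by (auto simp: y1_def y2_def max_def min_def)
  obtain B1 where k1: "bounded_kernel y1 B1"
    using clamped_bounded_kernel[OF assms(1,5)] unfolding y1_def by blast
  obtain B2 where k2: "bounded_kernel y2 B2"
    using clamped_bounded_kernel[OF assms(1,6)] unfolding y2_def by blast
  have fin1: "finite_borel_measure (y1 t)" and fin2: "finite_borel_measure (y2 t)" for t
    using bounded_kernel.finite_borel k1 k2 by blast+
  have s1: "solves_diffusion T b z0 y1" and s2: "solves_diffusion T b z0 y2"
    by (rule solves_diffusion_cong[OF assms(8)] solves_diffusion_cong[OF assms(9)];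
        simp add: y b_def)+
  define W where "W s \<xi> = (\<integral>x. b (s, x) *\<^sub>R iexp (\<xi> * x) \<partial>y1 s) - (\<integral>x. b (s, x) *\<^sub>R iexp (\<xi> * x) \<partial>y2 s)"
    for s \<xi>
  define Z where "Z s \<xi> = char (y1 s) \<xi> - char (y2 s) \<xi>" for s \<xi>
  have one: "(\<lambda>_. 1 :: real) \<in> borel_measurable (borel \<Otimes>\<^sub>M borel)" "\<And>p :: real \<times> real. \<bar>1 :: real\<bar> \<le> 1" by auto
  define C where "C = (K + 1) * (B1 + B2)"
  have B: "0 \<le> B1" "0 \<le> B2" using k1 k2 by (auto intro: bounded_kernel.B_nonneg)
  interpret fourier_evolution W Z C T
  proof
    show "case_prod W \<in> borel_measurable (borel \<Otimes>\<^sub>M borel)"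
      using borel_measurable_diff[OF kernel_transform(1)[OF k1 b b_abs]
          kernel_transform(1)[OF k2 b b_abs]]
      by (simp add: W_def case_prod_unfold)
    show "case_prod Z \<in> borel_measurable (borel \<Otimes>\<^sub>M borel)"
      using borel_measurable_diff[OF kernel_transform(1)[OF k1 one]
          kernel_transform(1)[OF k2 one]]
      by (simp add: Z_def char_def case_prod_unfold)
    show "norm (W s \<xi>) \<le> C" for s \<xi>
    proof -
      have "norm (W s \<xi>) \<le> K * B1 + K * B2"
        unfolding W_def by (intro order_trans[OF norm_triangle_ineq4] add_mono
            kernel_transform(2)[OF k1 b b_abs] kernel_transform(2)[OF k2 b b_abs])
      then show ?thesis using B by (simp add: C_def algebra_simps)
    qed
    show "norm (Z s \<xi>) \<le> C" for s \<xi>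
    proof -
      have "norm (Z s \<xi>) \<le> 1 * B1 + 1 * B2"
        unfolding Z_def char_def
        using kernel_transform(2)[OF k1 one, of s \<xi>] kernel_transform(2)[OF k2 one, of s \<xi>]
        by (intro order_trans[OF norm_triangle_ineq4] add_mono) simp_all
      also have "\<dots> \<le> C" using B K0 by (simp add: C_def algebra_simps)
      finally show ?thesis .
    qed
    show "Z t \<xi> = - (\<xi>\<^sup>2 *\<^sub>R (LBINT s:{0..t}. W s \<xi>))" if t: "t \<in> {0..T}" for t \<xi>
    proof -
      have int: "set_integrable lborel {0..t} (\<lambda>s. \<integral>x. b (s, x) *\<^sub>R iexp (\<xi> * x) \<partial>y s)"
        if k: "bounded_kernel y B" for y B
        unfolding set_integrable_def
      proof (rule Bochner_Integration.integrable_bound)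
        show "integrable lborel (\<lambda>s. K * B * indicat_real {0..t} s)"
          by (intro integrable_mult_right integrable_indicator_Icc)
        have "(\<lambda>s. (case_prod (\<lambda>s \<xi>. \<integral>x. b (s, x) *\<^sub>R iexp (\<xi> * x) \<partial>y s)) (s, \<xi>)) \<in> borel_measurable borel"
          by (rule measurable_compose[OF _ kernel_transform(1)[OF k b b_abs]]) simp
        then show "(\<lambda>s. indicat_real {0..t} s *\<^sub>R (\<integral>x. b (s, x) *\<^sub>R iexp (\<xi> * x) \<partial>y s)) \<in> borel_measurable lborel"
          by simp
        show "AE s in lborel. norm (indicat_real {0..t} s *\<^sub>R (\<integral>x. b (s, x) *\<^sub>R iexp (\<xi> * x) \<partial>y s))
            \<le> norm (K * B * indicat_real {0..t} s)"
          using order_trans[OF kernel_transform(2)[OF k b b_abs] abs_ge_self]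
          by (intro AE_I2) (simp split: split_indicator)
      qed
      show ?thesis
        unfolding Z_def W_def set_integral_diff(2)[OF int[OF k1] int[OF k2]]
        using bounded_kernel.solves_diffusion_char[OF k1 b b_abs assms(7) s1 t, of \<xi>]
          bounded_kernel.solves_diffusion_char[OF k2 b b_abs assms(7) s2 t, of \<xi>]
        by (simp add: scaleR_diff_right)
    qed
  qed
  have Z0: "Z t \<xi> = 0" if t: "t \<in> {0..T}" for t \<xi>
  proof (rule dissipative_imp_zero[OF _ _ t])
    show "continuous_on UNIV (Z t)" for t
      unfolding Z_def by (intro continuous_on_diff continuous_char fin1 fin2)
    fix \<kappa> t e :: real assume \<kappa>: "0 < \<kappa>" "\<kappa> \<le> t" "t \<le> T" and e: "0 < e"
    obtain D where D: "integrable lborel D" and slices: "AE s in lborel. s \<in> {\<kappa>..T} \<longrightarrow>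
        (\<exists>h. integrable lborel h \<and> integrable lborel (\<lambda>x. (h x)\<^sup>2) \<and> (\<integral>x. (h x)\<^sup>2 \<partial>lborel) = D s \<and>
       (\<forall>A\<in>sets borel. signed_diff (z1 s) (z2 s) A = (\<integral>x. indicator A x * h x \<partial>lborel)))"
      using square_integrable_density_slices[OF assms(10)[OF \<kappa>(1)] \<kappa>(1) assms(11)] by blast
    show "\<exists>\<delta>>0. \<delta> \<le> 1 \<and>
      - e \<le> (LBINT s:{\<kappa>..t}. (\<integral>\<xi>. exp (- (\<delta> * \<xi>)\<^sup>2 / 2) * (W s \<xi> \<bullet> Z s \<xi>) \<partial>lborel))"
    proof (rule dissipation_almost_nonnegative[OF W_measurable Z_measurable b b0 bK D _ e])
      show "AE s in lborel. s \<in> {\<kappa>..t} \<longrightarrow> (\<exists>h. integrable lborel h \<and>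
         integrable lborel (\<lambda>x. (h x)\<^sup>2) \<and> (\<integral>x. (h x)\<^sup>2 \<partial>lborel) = D s \<and>
         (\<forall>\<xi>. Z s \<xi> = (\<integral>x. h x *\<^sub>R iexp (\<xi> * x) \<partial>lborel)) \<and>
         (\<forall>\<xi>. W s \<xi> = (\<integral>x. (b (s, x) * h x) *\<^sub>R iexp (\<xi> * x) \<partial>lborel)))"
        using slices
      proof eventually_elim
        case (elim s)
        show ?case
        proof
          assume "s \<in> {\<kappa>..t}"
          then have s: "s \<in> {\<kappa>..T}" "s \<in> {0..T}" using \<kappa> by auto
          with elim obtain h where h: "integrable lborel h" "integrable lborel (\<lambda>x. (h x)\<^sup>2)"
            "(\<integral>x. (h x)\<^sup>2 \<partial>lborel) = D s"
            and dens: "\<And>A. A \<in> sets borel \<Longrightarrow>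
              signed_diff (z1 s) (z2 s) A = (\<integral>x. indicator A x * h x \<partial>lborel)" by blast
          have dens': "measure (y1 s) A - measure (y2 s) A = (\<integral>x. indicator A x * h x \<partial>lborel)"
            if "A \<in> sets borel" for A
            using dens[OF that] y[OF s(2)] by (simp add: signed_diff_def)
          have "Z s \<xi> = (\<integral>x. h x *\<^sub>R iexp (\<xi> * x) \<partial>lborel)" for \<xi>
            unfolding Z_def char_def
            by (rule signed_density_integral[OF fin1 fin2 h(1) dens', where M = 1]) auto
          moreover have "W s \<xi> = (\<integral>x. (b (s, x) * h x) *\<^sub>R iexp (\<xi> * x) \<partial>lborel)" for \<xi>
          proof -
            have "W s \<xi> = (\<integral>x. h x *\<^sub>R (b (s, x) *\<^sub>R iexp (\<xi> * x)) \<partial>lborel)"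
              unfolding W_def
              by (rule signed_density_integral[OF fin1 fin2 h(1) dens', where M = K]) (use b_abs in auto)
            then show ?thesis by (simp add: mult.commute)
          qed
          ultimately show "\<exists>h. integrable lborel h \<and>
             integrable lborel (\<lambda>x. (h x)\<^sup>2) \<and> (\<integral>x. (h x)\<^sup>2 \<partial>lborel) = D s \<and>
             (\<forall>\<xi>. Z s \<xi> = (\<integral>x. h x *\<^sub>R iexp (\<xi> * x) \<partial>lborel)) \<and>
             (\<forall>\<xi>. W s \<xi> = (\<integral>x. (b (s, x) * h x) *\<^sub>R iexp (\<xi> * x) \<partial>lborel))"
            using h by blast
        qed
      qed
    qed
  qed
  show ?thesis
  proof (intro ballI)
    fix t A assume t: "t \<in> {0..T}"
    have "char (y1 t) = char (y2 t)"
      using Z0[OF t] by (intro ext) (simp add: Z_def)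
    then have "y1 t = y2 t" by (rule finite_measure_char_uniqueness[OF fin1 fin2])
    then show "signed_diff (z1 t) (z2 t) A = 0" using y[OF t] by (simp add: signed_diff_def)
  qed
qed

end
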